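(* Let $\Gamma$ be a recursive game with $n$-stage values $v_n:X\to[-1,1]$. Suppose that the set $\{v_n : n\ge 1\}$ is totally bounded for the uniform norm $\|\cdot\|_\infty$. Then $\Gamma$ has a uniform value $v_\infty$. Moreover, both players can uniformly guarantee $v_\infty$ with strategies that depend only on the history of states and not on past actions.
   Context: A two-player zero-sum stochastic game $\Gamma=\langle X,A,B,g,q\rangle$ consists of a state space $X$ (a set), action sets $A,B$ with nonempty finite subsets $A(x)\subseteq A$, $B(x)\subseteq B$ of available actions for each $x\in X$, a payoff function $g:X\times A\times B\to[-1,1]$, and a transition function $q:X\times A\times B\to\Delta_f(X)$, where $\Delta_f(X)$ is the set of finitely supported probabilities on $X$. From an initial state $x_1$, at each stage $t\ge1$, both players, knowing $(x_1,a_1,b_1,\dots,a_{t-1},b_{t-1},x_t)$, simultaneously choose $a_t\in A(x_t)$, $b_t\in B(x_t)$; the stage payoff is $g(x_t,a_t,b_t)$, and $x_{t+1}$ is drawn from $q(x_t,a_t,b_t)$. $\Gamma$ is recursive if $X=X^0\cup X^*$ (disjoint) where $g(x,a,b)=0$ for all $x\in X^0$ (active states) and all $(a,b)\in A(x)\times B(x)$, and every $x\in X^*$ is absorbing: $q(x,a,b)(x)=1$ for all $(a,b)\in A(x)\times B(x)$ and $g(x,a,b)$ depends only on $x$. $H_t=(X\times A\times B)^{t-1}\times X$ is the set of histories at stage $t$. A (behavior) strategy of player 1 is a sequence $\sigma=(\sigma_t)_{t\ge1}$ with $\sigma_t:H_t\to\Delta(A)$ and $\sigma_t(h_t)(A(x_t))=1$;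 strategies $\tau$ of player 2 are defined similarly. $\Sigma,\mathcal T$ are the sets of strategies of players 1 and 2. $\mathbb E_{x_1,\sigma,\tau}$ is the expectation on plays induced by $(x_1,\sigma,\tau)$, and $\gamma_n(x_1,\sigma,\tau)=\mathbb E_{x_1,\sigma,\tau}\big(\frac1n\sum_{t=1}^n g(x_t,a_t,b_t)\big)$. Player 1 maximizes, player 2 minimizes; $v_n(x_1)$ is the value of the $n$-stage game with payoff $\gamma_n(x_1,\cdot,\cdot)$. Player 1 uniformly guarantees $w:X\to\mathbb R$ if for every $\varepsilon>0$ there are $\sigma_\varepsilon\in\Sigma$ and $N_0\ge1$ such that for every $x_1\in X^0$, all $n\ge N_0$ and all $\tau\in\mathcal T$, $\gamma_n(x_1,\sigma_\varepsilon,\tau)\ge w(x_1)-\varepsilon$. Player 2 uniformly guarantees $w$ if for every $\varepsilon>0$ there are $\tau_\varepsilon\in\mathcal T$, $N_0\ge1$ such that for every $x_1\in X^0$, all $n\ge N_0$ and all $\sigma\in\Sigma$, $\gamma_n(x_1,\sigma,\tau_\varepsilon)\le w(x_1)+\varepsilon$. $v_\infty:X\to\mathbb R$ is the uniform value of $\Gamma$ if both players uniformly guarantee $v_\infty$. A player uniformly guarantees $w$ with strategies of a given class if the strategies $\sigma_\varepsilon$ (resp. $\tau_\varepsilon$) can be taken in that class. *)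

theory Defs
  imports "HOL-Probability.Probability"
begin

(* The state space X and the ambient action sets A, B are the types 'x, 'a, 'b;
   acts1 and acts2 give the available actions A(x), B(x). *)
record ('x, 'a, 'b) stochastic_game =
  acts1 :: "'x \<Rightarrow> 'a set"
  acts2 :: "'x \<Rightarrow> 'b set"
  payoff :: "'x \<Rightarrow> 'a \<Rightarrow> 'b \<Rightarrow> real"
  trans_prob :: "'x \<Rightarrow> 'a \<Rightarrow> 'b \<Rightarrow> 'x pmf"

definition is_stochastic_game :: "('x, 'a, 'b) stochastic_game \<Rightarrow> bool" where
  "is_stochastic_game \<Gamma> \<longleftrightarrow>
     (\<forall>x. finite (acts1 \<Gamma> x) \<and> acts1 \<Gamma> x \<noteq> {}) \<and>
     (\<forall>x. finite (acts2 \<Gamma> x) \<and> acts2 \<Gamma> x \<noteq> {}) \<and>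
     (\<forall>x a b. payoff \<Gamma> x a b \<in> {-1..1}) \<and>
     (\<forall>x a b. finite (set_pmf (trans_prob \<Gamma> x a b)))"

(* X0 is the set of active states and - X0 the set of absorbing ones. The game does not
   determine X0: an absorbing state with payoff 0 may lie on either side. *)
definition recursive_game :: "('x, 'a, 'b) stochastic_game \<Rightarrow> 'x set \<Rightarrow> bool" where
  "recursive_game \<Gamma> X0 \<longleftrightarrow>
     is_stochastic_game \<Gamma> \<and>
     (\<forall>x\<in>X0. \<forall>a\<in>acts1 \<Gamma> x. \<forall>b\<in>acts2 \<Gamma> x. payoff \<Gamma> x a b = 0) \<and>
     (\<forall>x\<in>- X0. \<forall>a\<in>acts1 \<Gamma> x. \<forall>b\<in>acts2 \<Gamma> x. pmf (trans_prob \<Gamma> x a b) x = 1) \<and>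
     (\<forall>x\<in>- X0. \<exists>c. \<forall>a\<in>acts1 \<Gamma> x. \<forall>b\<in>acts2 \<Gamma> x. payoff \<Gamma> x a b = c)"

(* A history at stage t is (h, x): h lists the t - 1 past triples (state, action of player 1,
   action of player 2), oldest first, and x is the current state. One function on lists of
   every length encodes the whole sequence of maps H_t -> Delta(A). *)
type_synonym ('x, 'a, 'b) past = "('x \<times> 'a \<times> 'b) list"
type_synonym ('x, 'a, 'b, 'c) strategy = "('x, 'a, 'b) past \<Rightarrow> 'x \<Rightarrow> 'c pmf"

definition strategies1 ::
    "('x, 'a, 'b) stochastic_game \<Rightarrow> ('x, 'a, 'b, 'a) strategy set" where
  "strategies1 \<Gamma> = {\<sigma>. \<forall>h x. set_pmf (\<sigma> h x) \<subseteq> acts1 \<Gamma> x}"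

definition strategies2 ::
    "('x, 'a, 'b) stochastic_game \<Rightarrow> ('x, 'a, 'b, 'b) strategy set" where
  "strategies2 \<Gamma> = {\<tau>. \<forall>h x. set_pmf (\<tau> h x) \<subseteq> acts2 \<Gamma> x}"

definition state_history_strategies :: "('x, 'a, 'b, 'c) strategy set" where
  "state_history_strategies =
     {\<sigma>. \<forall>h h' x. map fst h = map fst h' \<longrightarrow> \<sigma> h x = \<sigma> h' x}"

(* Law of the history (x_1, a_1, b_1, ..., x_n, a_n, b_n, x_{n+1}) induced by (x_1, sigma, tau);
   the payoff of the n-stage game depends on a play only through this history. *)
primrec history_pmf ::
    "('x, 'a, 'b) stochastic_game \<Rightarrow> 'x \<Rightarrow> ('x, 'a, 'b, 'a) strategy \<Rightarrow>
     ('x, 'a, 'b, 'b) strategy \<Rightarrow> nat \<Rightarrow> (('x, 'a, 'b) past \<times> 'x) pmf" where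
  "history_pmf \<Gamma> x\<^sub>1 \<sigma> \<tau> 0 = return_pmf ([], x\<^sub>1)"
| "history_pmf \<Gamma> x\<^sub>1 \<sigma> \<tau> (Suc n) =
     do {
       (h, x) \<leftarrow> history_pmf \<Gamma> x\<^sub>1 \<sigma> \<tau> n;
       a \<leftarrow> \<sigma> h x;
       b \<leftarrow> \<tau> h x;
       y \<leftarrow> trans_prob \<Gamma> x a b;
       return_pmf (h @ [(x, a, b)], y)
     }"

definition mean_payoff ::
    "('x, 'a, 'b) stochastic_game \<Rightarrow> nat \<Rightarrow> 'x \<Rightarrow> ('x, 'a, 'b, 'a) strategy \<Rightarrow>
     ('x, 'a, 'b, 'b) strategy \<Rightarrow> real" where
  "mean_payoff \<Gamma> n x\<^sub>1 \<sigma> \<tau> =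
     measure_pmf.expectation (history_pmf \<Gamma> x\<^sub>1 \<sigma> \<tau> n)
       (\<lambda>(h, y). (1 / real n) * (\<Sum>(x, a, b)\<leftarrow>h. payoff \<Gamma> x a b))"

definition is_n_stage_value ::
    "('x, 'a, 'b) stochastic_game \<Rightarrow> nat \<Rightarrow> 'x \<Rightarrow> real \<Rightarrow> bool" where
  "is_n_stage_value \<Gamma> n x\<^sub>1 v \<longleftrightarrow>
     v = (SUP \<sigma>\<in>strategies1 \<Gamma>. INF \<tau>\<in>strategies2 \<Gamma>. mean_payoff \<Gamma> n x\<^sub>1 \<sigma> \<tau>) \<and>
     v = (INF \<tau>\<in>strategies2 \<Gamma>. SUP \<sigma>\<in>strategies1 \<Gamma>. mean_payoff \<Gamma> n x\<^sub>1 \<sigma> \<tau>)"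

definition n_stage_value :: "('x, 'a, 'b) stochastic_game \<Rightarrow> nat \<Rightarrow> 'x \<Rightarrow> real" where
  "n_stage_value \<Gamma> n x\<^sub>1 = (THE v. is_n_stage_value \<Gamma> n x\<^sub>1 v)"

(* In the next two definitions S is the class in which the strategies are to be found. *)
definition uniformly_guarantees1 ::
    "('x, 'a, 'b) stochastic_game \<Rightarrow> 'x set \<Rightarrow> ('x, 'a, 'b, 'a) strategy set \<Rightarrow>
     ('x \<Rightarrow> real) \<Rightarrow> bool" where
  "uniformly_guarantees1 \<Gamma> X0 S w \<longleftrightarrow>
     (\<forall>\<epsilon>>0. \<exists>\<sigma>\<in>strategies1 \<Gamma> \<inter> S. \<exists>N\<ge>1. \<forall>x\<^sub>1\<in>X0. \<forall>n\<ge>N. \<forall>\<tau>\<in>strategies2 \<Gamma>.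
        mean_payoff \<Gamma> n x\<^sub>1 \<sigma> \<tau> \<ge> w x\<^sub>1 - \<epsilon>)"

definition uniformly_guarantees2 ::
    "('x, 'a, 'b) stochastic_game \<Rightarrow> 'x set \<Rightarrow> ('x, 'a, 'b, 'b) strategy set \<Rightarrow>
     ('x \<Rightarrow> real) \<Rightarrow> bool" where
  "uniformly_guarantees2 \<Gamma> X0 S w \<longleftrightarrow>
     (\<forall>\<epsilon>>0. \<exists>\<tau>\<in>strategies2 \<Gamma> \<inter> S. \<exists>N\<ge>1. \<forall>x\<^sub>1\<in>X0. \<forall>n\<ge>N. \<forall>\<sigma>\<in>strategies1 \<Gamma>.
        mean_payoff \<Gamma> n x\<^sub>1 \<sigma> \<tau> \<le> w x\<^sub>1 + \<epsilon>)"

definition is_uniform_value ::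
    "('x, 'a, 'b) stochastic_game \<Rightarrow> 'x set \<Rightarrow> ('x \<Rightarrow> real) \<Rightarrow> bool" where
  "is_uniform_value \<Gamma> X0 w \<longleftrightarrow>
     uniformly_guarantees1 \<Gamma> X0 UNIV w \<and> uniformly_guarantees2 \<Gamma> X0 UNIV w"

(* Bounded real functions on 'x with the distance of the uniform norm. *)
abbreviation sup_metric :: "('x \<Rightarrow> real) metric" where
  "sup_metric \<equiv> funspace UNIV euclidean_metric"

definition totally_bounded_sup :: "('x \<Rightarrow> real) set \<Rightarrow> bool" where
  "totally_bounded_sup F \<longleftrightarrow>
     Metric_space.mtotally_bounded (mspace sup_metric) (mdist sup_metric) F"

end

theory Submission
  imports Defs
begin

text \<open>Write \<open>v\<^sub>n\<close> for the \<open>n\<close>-stage value and \<open>T f x\<close> for the value of the one-shot game at \<open>x\<close> in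
  which the payoff is the expectation of \<open>f\<close> at the next state. On active states nothing is earned,
  so \<open>(n + 1) * v\<^sub>n\<^sub>+\<^sub>1 = n * T v\<^sub>n\<close>: along optimal play the remaining value is a submartingale, and
  it strictly grows where it is positive.

  Let \<open>u\<close> be the pointwise upper limit of the \<open>v\<^sub>n\<close>. Total boundedness enters in the form of
  recurrence: up to any \<open>\<delta>\<close>, every late \<open>v\<^sub>n\<close> is matched by one of finitely many \<open>v\<^sub>j\<close> with \<open>j\<close> as large
  as desired (\<open>recurrent_nets_of_totally_bounded\<close>). Hence \<open>v\<^sub>n \<le> u + \<delta>\<close> uniformly for late \<open>n\<close>, and
  \<open>u \<le> T u\<close> on active states. If player 1 only protected \<open>u\<close>, play could stay active forever at
  payoff 0 although \<open>u > 0\<close>; playing long finite games in succession instead loses some \<open>\<delta>\<close> at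
  every change of the horizon. The two are reconciled in a single function
  \<open>\<Phi>\<close>, within \<open>\<epsilon>\<close> of \<open>u\<close>: the pointwise maximum of \<open>u\<close> and of finitely many slightly steeper affine
  images of values \<open>v\<^sub>m\<close> (\<open>potential_exists\<close>). It satisfies \<open>\<Phi> \<le> T \<Phi>\<close> on active states, and
  \<open>\<Phi> + c \<le> T \<Phi>\<close> for some \<open>c > 0\<close> where moreover \<open>u > \<epsilon>\<close>.

  Playing at each state optimally in the one-shot game for \<open>\<Phi>\<close> is a stationary strategy, so it
  depends on the history of states only. It makes \<open>\<Phi>\<close> a submartingale, and because \<open>\<Phi>\<close> is bounded the
  expected number of stages at active states with \<open>u > \<epsilon>\<close> is at most of order \<open>1 / c\<close>,
  whatever player 2 does. At all other stages the stage payoff is at least \<open>\<Phi> - 2 * \<epsilon>\<close>. So player 1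
  uniformly guarantees \<open>u\<close> (\<open>player1_guarantees\<close>).

  The construction applied to \<open>- v\<^sub>n\<close> shows that player 2 uniformly guarantees the lower limit of
  the \<open>v\<^sub>n\<close>, and a fortiori \<open>u\<close>; so \<open>u\<close> is the uniform value.

  Two preliminaries connect this with the definitions. The one-shot games need exact optimal
  mixed actions, that is the minimax theorem (\<open>matrix_value_exists\<close>), and the \<open>n\<close>-stage values need
  Shapley's recursion (\<open>n_stage_value_eq\<close>). The recursion and the final guarantees rest on
  the same submartingale estimate, \<open>total_payoff_ge\<close>.\<close>

section \<open>Expectations of finitely supported distributions\<close>

lemma expectation_finite_support:
  fixes f :: "'a \<Rightarrow> real"
  assumes "finite A" "set_pmf p \<subseteq> A"
  shows "measure_pmf.expectation p f = (\<Sum>a\<in>A. pmf p a * f a)"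
  using assms by (subst integral_measure_pmf_real[of A]) (auto simp: mult.commute)

lemma expectation_bind_finite_support:
  fixes h :: "'b \<Rightarrow> real"
  assumes "finite (set_pmf p)" "\<And>x. x \<in> set_pmf p \<Longrightarrow> finite (set_pmf (f x))"
  shows "measure_pmf.expectation (bind_pmf p f) h =
         measure_pmf.expectation p (\<lambda>x. measure_pmf.expectation (f x) h)"
proof -
  have "measure_pmf.expectation (bind_pmf p f) h =
        (\<Sum>a\<in>set_pmf p. pmf p a *\<^sub>R measure_pmf.expectation (f a) h)"
    using assms by (intro pmf_expectation_bind) auto
  also have "\<dots> = measure_pmf.expectation p (\<lambda>x. measure_pmf.expectation (f x) h)"
    using assms(1) by (simp add: expectation_finite_support[of "set_pmf p"])
  finally show ?thesis .
qed

lemma expectation_mono_finite_support: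
  fixes f g :: "'a \<Rightarrow> real"
  assumes "finite (set_pmf p)" "\<And>x. x \<in> set_pmf p \<Longrightarrow> f x \<le> g x"
  shows "measure_pmf.expectation p f \<le> measure_pmf.expectation p g"
  using assms by (auto simp: expectation_finite_support[of "set_pmf p"] intro!: sum_mono mult_left_mono)

lemma expectation_affine_finite_support:
  fixes f :: "'a \<Rightarrow> real"
  assumes "finite (set_pmf p)"
  shows "measure_pmf.expectation p (\<lambda>x. \<alpha> * f x + \<beta>) = \<alpha> * measure_pmf.expectation p f + \<beta>"
proof -
  have "measure_pmf.expectation p (\<lambda>x. \<alpha> * f x + \<beta>) =
        measure_pmf.expectation p (\<lambda>x. \<alpha> * f x) + measure_pmf.expectation p (\<lambda>x. \<beta>)"
    by (intro Bochner_Integration.integral_add) (use assms in \<open>auto intro: integrable_measure_pmf_finite\<close>)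
  then show ?thesis by simp
qed

lemma expectation_add_const:
  fixes f :: "'a \<Rightarrow> real"
  assumes "finite (set_pmf p)"
  shows "measure_pmf.expectation p (\<lambda>x. f x + c) = measure_pmf.expectation p f + c"
  using expectation_affine_finite_support[OF assms, of 1 f c] by simp

lemma expectation_diff_const:
  fixes f :: "'a \<Rightarrow> real"
  assumes "finite (set_pmf p)"
  shows "measure_pmf.expectation p (\<lambda>x. f x - c) = measure_pmf.expectation p f - c"
  using expectation_add_const[OF assms, of f "- c"] by simp

lemma expectation_swap_finite_support:
  fixes M :: "'a \<Rightarrow> 'b \<Rightarrow> real"
  assumes "finite (set_pmf p)" "finite (set_pmf q)"
  shows "measure_pmf.expectation p (\<lambda>a. measure_pmf.expectation q (M a)) =
         measure_pmf.expectation q (\<lambda>b. measure_pmf.expectation p (\<lambda>a. M a b))"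
  using assms
  by (simp add: expectation_finite_support[of "set_pmf p"] expectation_finite_support[of "set_pmf q"]
      sum_distrib_left sum.swap[of _ "set_pmf p"] mult.left_commute)

lemma expectation_ge_const:
  fixes f :: "'a \<Rightarrow> real"
  assumes "finite (set_pmf p)" "\<And>x. x \<in> set_pmf p \<Longrightarrow> c \<le> f x"
  shows "c \<le> measure_pmf.expectation p f"
  using expectation_mono_finite_support[OF assms(1), of "\<lambda>_. c" f] assms(2) by simp

lemma expectation_le_const:
  fixes f :: "'a \<Rightarrow> real"
  assumes "finite (set_pmf p)" "\<And>x. x \<in> set_pmf p \<Longrightarrow> f x \<le> c"
  shows "measure_pmf.expectation p f \<le> c"
  using expectation_mono_finite_support[OF assms(1), of f "\<lambda>_. c"] assms(2) by simp

section \<open>Finite matrix games\<close>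

definition simplex_on :: "'a set \<Rightarrow> ('a \<Rightarrow> real) set" where
  "simplex_on A = {w. (\<forall>a. w a \<in> (if a \<in> A then {0..1} else {0})) \<and> sum w A = 1}"

lemma compact_simplex_on:
  assumes "finite A"
  shows "compact (simplex_on A)"
proof -
  let ?box = "PiE UNIV (\<lambda>a. if a \<in> A then {0..1::real} else {0})"
  have "compactin (product_topology (\<lambda>_. euclidean) UNIV) ?box"
    by (subst compactin_PiE) auto
  then have "compact ?box"
    by (simp add: euclidean_product_topology flip: compactin_euclidean_iff)
  moreover have "closed {w :: 'a \<Rightarrow> real. sum w A = 1}"
    by (intro closed_Collect_eq continuous_intros) auto
  moreover have "simplex_on A = ?box \<inter> {w. sum w A = 1}"
    unfolding simplex_on_def PiE_UNIV_domain Pi_def by auto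
  ultimately show ?thesis by auto
qed

lemma pmf_of_weights:
  assumes "finite A" "\<And>a. a \<in> A \<Longrightarrow> 0 \<le> w a" "sum w A = (1::real)"
  obtains p where "set_pmf p \<subseteq> A" "\<And>a. a \<in> A \<Longrightarrow> pmf p a = w a"
proof -
  define w' where "w' a = (if a \<in> A then w a else 0)" for a
  have nn: "0 \<le> w' a" for a using assms(2) by (auto simp: w'_def)
  have "(\<integral>\<^sup>+a. ennreal (w' a) \<partial>count_space UNIV) = (\<Sum>a\<in>A. ennreal (w' a))"
    by (rule nn_integral_count_space'[OF assms(1)]) (auto simp: w'_def)
  also have "\<dots> = ennreal (\<Sum>a\<in>A. w' a)" using nn by (intro sum_ennreal) auto
  also have "(\<Sum>a\<in>A. w' a) = 1" using assms(3) by (simp add: w'_def)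
  finally have one: "(\<integral>\<^sup>+a. ennreal (w' a) \<partial>count_space UNIV) = 1" by simp
  show ?thesis
  proof
    show "set_pmf (embed_pmf w') \<subseteq> A"
      unfolding set_embed_pmf[OF nn one] by (auto simp: w'_def)
    show "pmf (embed_pmf w') a = w a" if "a \<in> A" for a
      unfolding pmf_embed_pmf[OF nn one] using that by (simp add: w'_def)
  qed
qed

text \<open>The derivative of \<open>s \<mapsto> (max 0 s)\<^sup>2\<close> is \<open>2 * max 0 s\<close>, and it is 2-Lipschitz.\<close>

lemma pos_part_square_le:
  fixes s h :: real
  shows "(max 0 (s + h))\<^sup>2 \<le> (max 0 s)\<^sup>2 + 2 * max 0 s * h + h\<^sup>2"
proof (cases "s \<ge> 0")
  case True
  have "(max 0 (s + h))\<^sup>2 \<le> (s + h)\<^sup>2" by (auto simp: max_def)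
  with True show ?thesis by (simp add: power2_sum)
next
  case False
  have "max 0 (s + h) \<le> \<bar>h\<bar>" using False by auto
  then have "(max 0 (s + h))\<^sup>2 \<le> \<bar>h\<bar>\<^sup>2" by (intro power_mono) auto
  with False show ?thesis by simp
qed

lemma nonneg_of_quadratic_bound:
  fixes s c :: real
  assumes "\<And>t. 0 < t \<Longrightarrow> t \<le> 1 \<Longrightarrow> 0 \<le> 2 * t * s + t\<^sup>2 * c" "c \<ge> 0"
  shows "s \<ge> 0"
proof (rule ccontr)
  assume "\<not> s \<ge> 0"
  define t where "t = min 1 (- s / (c + 1))"
  have t: "0 < t" "t \<le> 1" "t \<le> - s / (c + 1)" using \<open>\<not> s \<ge> 0\<close> \<open>c \<ge> 0\<close>
    by (auto simp: t_def divide_neg_pos)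
  have "t * (c + 1) \<le> - s" using t(3) \<open>c \<ge> 0\<close> by (simp add: field_simps)
  then have "2 * s + t * c < 0" using t \<open>\<not> s \<ge> 0\<close> by (simp add: algebra_simps)
  moreover have "0 \<le> t * (2 * s + t * c)"
    using assms(1)[OF t(1,2)] by (simp add: algebra_simps power2_eq_square)
  ultimately show False using t(1) by (simp add: zero_le_mult_iff)
qed

text \<open>The column mixture \<open>q\<close> is chosen to minimise the squared length of the positive part of the
  vector of row payoffs. If that positive part vanishes, \<open>q\<close> holds every row to at most 0;
  otherwise it is, up to normalisation, a row mixture, and the first-order condition at the
  minimum says that it earns more than 0 against every column.\<close>

lemma matrix_game_alternative:
  fixes M :: "'a \<Rightarrow> 'b \<Rightarrow> real"
  assumes fin: "finite A" "finite B" and B: "B \<noteq> {}"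
  shows "(\<exists>q. set_pmf q \<subseteq> B \<and> (\<forall>a\<in>A. measure_pmf.expectation q (M a) \<le> 0)) \<or>
         (\<exists>p. set_pmf p \<subseteq> A \<and> (\<forall>b\<in>B. 0 < measure_pmf.expectation p (\<lambda>a. M a b)))"
proof -
  define y where "y w a = (\<Sum>b\<in>B. w b * M a b)" for w a
  define \<phi> where "\<phi> w = (\<Sum>a\<in>A. (max 0 (y w a))\<^sup>2)" for w
  obtain b0 where "b0 \<in> B" using B by auto
  have "(\<lambda>b. if b = b0 then 1 else 0) \<in> simplex_on B"
    using \<open>b0 \<in> B\<close> fin by (auto simp: simplex_on_def)
  then have ne: "simplex_on B \<noteq> {}" by auto
  have "continuous_on (simplex_on B) \<phi>"
    unfolding \<phi>_def y_def
    by (intro continuous_intros continuous_on_subset[OF continuous_on_product_coordinates]) auto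
  then obtain w where w: "w \<in> simplex_on B" and min: "\<And>w'. w' \<in> simplex_on B \<Longrightarrow> \<phi> w \<le> \<phi> w'"
    using continuous_attains_inf[OF compact_simplex_on[OF fin(2)] ne] by blast
  have w01: "\<And>b. b \<in> B \<Longrightarrow> 0 \<le> w b \<and> w b \<le> 1" and wsum: "sum w B = 1"
    and wout: "\<And>b. b \<notin> B \<Longrightarrow> w b = 0"
    using w by (auto simp: simplex_on_def split: if_splits)
  define r where "r a = max 0 (y w a)" for a
  have r0: "r a \<ge> 0" for a by (simp add: r_def)
  have first_order: "0 \<le> (\<Sum>a\<in>A. r a * (M a b - y w a))" if b: "b \<in> B" for b
  proof (rule nonneg_of_quadratic_bound)
    show "0 \<le> (\<Sum>a\<in>A. (M a b - y w a)\<^sup>2)" by (simp add: sum_nonneg)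
    fix t :: real assume t: "0 < t" "t \<le> 1"
    define w' where "w' c = (1 - t) * w c + t * (if c = b then 1 else 0)" for c
    have "w' \<in> simplex_on B"
    proof -
      have "sum w' B = (1 - t) * sum w B + t * (\<Sum>c\<in>B. if c = b then 1 else 0)"
        by (simp add: w'_def sum.distrib sum_distrib_left)
      then have "sum w' B = 1" using b fin wsum by simp
      moreover have "0 \<le> w' c \<and> w' c \<le> 1" if "c \<in> B" for c
      proof -
        have "(1 - t) * w c \<le> 1 - t" "0 \<le> (1 - t) * w c"
          using w01[OF that] t by (auto intro: mult_left_le)
        then show ?thesis using t by (auto simp: w'_def)
      qed
      moreover have "w' c = 0" if "c \<notin> B" for c
        using wout[OF that] that b by (auto simp: w'_def)
      ultimately show ?thesis by (auto simp: simplex_on_def)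
    qed
    from min[OF this] have "\<phi> w \<le> \<phi> w'" .
    moreover have "y w' a = y w a + t * (M a b - y w a)" for a
    proof -
      have "y w' a = (\<Sum>c\<in>B. (1 - t) * (w c * M a c) + t * (if c = b then M a c else 0))"
        unfolding y_def w'_def by (intro sum.cong) (auto simp: algebra_simps)
      also have "\<dots> = (1 - t) * y w a + t * M a b"
        using b fin by (simp add: y_def sum.distrib flip: sum_distrib_left)
      finally show ?thesis by (simp add: algebra_simps)
    qed
    moreover have "(\<Sum>a\<in>A. (max 0 (y w a + t * (M a b - y w a)))\<^sup>2)
        \<le> (\<Sum>a\<in>A. (r a)\<^sup>2 + 2 * r a * (t * (M a b - y w a)) + (t * (M a b - y w a))\<^sup>2)"
      unfolding r_def by (intro sum_mono pos_part_square_le)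
    ultimately have "\<phi> w \<le> (\<Sum>a\<in>A. (r a)\<^sup>2 + 2 * r a * (t * (M a b - y w a)) + (t * (M a b - y w a))\<^sup>2)"
      by (simp add: \<phi>_def)
    also have "\<dots> = \<phi> w + (2 * t * (\<Sum>a\<in>A. r a * (M a b - y w a)) + t\<^sup>2 * (\<Sum>a\<in>A. (M a b - y w a)\<^sup>2))"
      by (simp add: \<phi>_def r_def sum.distrib sum_distrib_left power_mult_distrib mult_ac)
    finally show "0 \<le> 2 * t * (\<Sum>a\<in>A. r a * (M a b - y w a)) + t\<^sup>2 * (\<Sum>a\<in>A. (M a b - y w a)\<^sup>2)"
      by simp
  qed
  show ?thesis
  proof (cases "\<forall>a\<in>A. y w a \<le> 0")
    case True
    obtain q where q: "set_pmf q \<subseteq> B" "\<And>b. b \<in> B \<Longrightarrow> pmf q b = w b"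
      using pmf_of_weights[of B w] fin w01 wsum by metis
    have "measure_pmf.expectation q (M a) = y w a" for a
      using q fin by (auto simp: expectation_finite_support[of B] y_def)
    with True q show ?thesis by auto
  next
    case False
    then obtain a0 where a0: "a0 \<in> A" "y w a0 > 0" by force
    define s where "s = sum r A"
    have "r a0 \<le> s" unfolding s_def by (intro member_le_sum) (use a0 fin r0 in auto)
    then have s: "s > 0" using a0 by (auto simp: r_def)
    have "(\<Sum>a\<in>A. r a / s) = 1" using s by (simp add: s_def flip: sum_divide_distrib)
    then obtain p where p: "set_pmf p \<subseteq> A" "\<And>a. a \<in> A \<Longrightarrow> pmf p a = r a / s"
      using pmf_of_weights[of A "\<lambda>a. r a / s"] fin s r0 by (metis divide_nonneg_pos)
    have "0 < measure_pmf.expectation p (\<lambda>a. M a b)" if b: "b \<in> B" for b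
    proof -
      have "(r a0)\<^sup>2 \<le> (\<Sum>a\<in>A. (r a)\<^sup>2)" by (intro member_le_sum) (use a0 fin in auto)
      moreover have "(\<Sum>a\<in>A. (r a)\<^sup>2) = (\<Sum>a\<in>A. r a * y w a)"
        by (intro sum.cong) (auto simp: r_def power2_eq_square max_def)
      moreover have "(r a0)\<^sup>2 > 0" using a0 unfolding r_def by (intro zero_less_power) auto
      ultimately have "0 < (\<Sum>a\<in>A. r a * M a b)"
        using first_order[OF b] unfolding right_diff_distrib sum_subtractf by linarith
      moreover have "measure_pmf.expectation p (\<lambda>a. M a b) = (\<Sum>a\<in>A. r a * M a b) / s"
        using p fin by (simp add: expectation_finite_support[of A] sum_divide_distrib)
      ultimately show ?thesis using s by simp
    qed
    with p show ?thesis by auto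
  qed
qed

definition is_matrix_value :: "'a set \<Rightarrow> 'b set \<Rightarrow> ('a \<Rightarrow> 'b \<Rightarrow> real) \<Rightarrow> real \<Rightarrow> bool" where
  "is_matrix_value A B M v \<longleftrightarrow>
     (\<exists>p. set_pmf p \<subseteq> A \<and> (\<forall>b\<in>B. v \<le> measure_pmf.expectation p (\<lambda>a. M a b))) \<and>
     (\<exists>q. set_pmf q \<subseteq> B \<and> (\<forall>a\<in>A. measure_pmf.expectation q (M a) \<le> v))"

definition matrix_value :: "'a set \<Rightarrow> 'b set \<Rightarrow> ('a \<Rightarrow> 'b \<Rightarrow> real) \<Rightarrow> real" where
  "matrix_value A B M = (THE v. is_matrix_value A B M v)"

lemma weak_duality:
  fixes M M' :: "'a \<Rightarrow> 'b \<Rightarrow> real"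
  assumes fin: "finite A" "finite B"
    and p: "set_pmf p \<subseteq> A" "\<And>b. b \<in> B \<Longrightarrow> v \<le> measure_pmf.expectation p (\<lambda>a. M a b)"
    and q: "set_pmf q \<subseteq> B" "\<And>a. a \<in> A \<Longrightarrow> measure_pmf.expectation q (M' a) \<le> v'"
    and le: "\<And>a b. a \<in> A \<Longrightarrow> b \<in> B \<Longrightarrow> M a b \<le> M' a b"
  shows "v \<le> v'"
proof -
  have finp: "finite (set_pmf p)" "finite (set_pmf q)" using fin p q by (auto intro: finite_subset)
  have "v = measure_pmf.expectation q (\<lambda>_. v)" by simp
  also have "\<dots> \<le> measure_pmf.expectation q (\<lambda>b. measure_pmf.expectation p (\<lambda>a. M a b))"
    using finp p q by (intro expectation_mono_finite_support) auto
  also have "\<dots> = measure_pmf.expectation p (\<lambda>a. measure_pmf.expectation q (M a))"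
    using finp by (intro expectation_swap_finite_support[symmetric])
  also have "\<dots> \<le> measure_pmf.expectation p (\<lambda>a. measure_pmf.expectation q (M' a))"
    using finp p(1) q(1) by (intro expectation_mono_finite_support le) auto
  also have "\<dots> \<le> measure_pmf.expectation p (\<lambda>_. v')"
    using finp p q by (intro expectation_mono_finite_support) auto
  finally show ?thesis by simp
qed

text \<open>Let \<open>v\<close> be the infimum of the levels to which the column player can hold the row player.
  Every strategy that beats \<open>v\<close> beats it by a margin, since there are finitely many columns, so
  the alternative forces the infimum to be attained.\<close>

lemma column_optimum_exists:
  fixes M :: "'a \<Rightarrow> 'b \<Rightarrow> real"
  assumes fin: "finite A" "finite B" and ne: "A \<noteq> {}" "B \<noteq> {}"
  obtains v q where "set_pmf q \<subseteq> B" "\<And>a. a \<in> A \<Longrightarrow> measure_pmf.expectation q (M a) \<le> v"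
    "\<And>t. t < v \<Longrightarrow> \<exists>p. set_pmf p \<subseteq> A \<and> (\<forall>b\<in>B. t < measure_pmf.expectation p (\<lambda>a. M a b))"
proof -
  define S where "S = {t. \<exists>q. set_pmf q \<subseteq> B \<and> (\<forall>a\<in>A. measure_pmf.expectation q (M a) \<le> t)}"
  have alt: "t \<in> S \<or> (\<exists>p. set_pmf p \<subseteq> A \<and> (\<forall>b\<in>B. t < measure_pmf.expectation p (\<lambda>a. M a b)))" for t
  proof -
    have "measure_pmf.expectation q (\<lambda>b. M a b - t) = measure_pmf.expectation q (M a) - t"
      if "set_pmf q \<subseteq> B" for q a
      by (rule expectation_diff_const) (use that fin in \<open>auto intro: finite_subset\<close>)
    moreover have "measure_pmf.expectation p (\<lambda>a. M a b - t) = measure_pmf.expectation p (\<lambda>a. M a b) - t"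
      if "set_pmf p \<subseteq> A" for p b
      by (rule expectation_diff_const) (use that fin in \<open>auto intro: finite_subset\<close>)
    ultimately show ?thesis
      using matrix_game_alternative[OF fin ne(2), of "\<lambda>a b. M a b - t"]
      unfolding S_def mem_Collect_eq by (elim disj_forward ex_forward) auto
  qed
  have lower: "t0 \<le> t" if "set_pmf p \<subseteq> A" "\<And>b. b \<in> B \<Longrightarrow> t0 \<le> measure_pmf.expectation p (\<lambda>a. M a b)"
    "t \<in> S" for p t0 t
  proof -
    from \<open>t \<in> S\<close> obtain q where "set_pmf q \<subseteq> B" "\<And>a. a \<in> A \<Longrightarrow> measure_pmf.expectation q (M a) \<le> t"
      unfolding S_def by auto
    then show ?thesis using weak_duality[OF fin that(1,2), where q = q and M' = M and v' = t] by auto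
  qed
  have bdd: "bdd_below S"
  proof -
    obtain a where a: "a \<in> A" using ne by auto
    have "Min (M a ` B) \<le> measure_pmf.expectation (return_pmf a) (\<lambda>a. M a b)" if "b \<in> B" for b
      using that fin by auto
    then show ?thesis using lower[of "return_pmf a" "Min (M a ` B)"] a by (intro bdd_belowI) auto
  qed
  have "S \<noteq> {}"
  proof -
    obtain b where b: "b \<in> B" using ne by auto
    have "Max ((\<lambda>a. M a b) ` A) \<in> S" unfolding S_def
      using b fin by (intro CollectI exI[of _ "return_pmf b"]) auto
    then show ?thesis by auto
  qed
  have "Inf S \<in> S"
  proof (rule ccontr)
    assume "Inf S \<notin> S"
    then obtain p where p: "set_pmf p \<subseteq> A" "\<forall>b\<in>B. Inf S < measure_pmf.expectation p (\<lambda>a. M a b)"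
      using alt by blast
    define t0 where "t0 = Min ((\<lambda>b. measure_pmf.expectation p (\<lambda>a. M a b)) ` B)"
    have "t0 \<le> Inf S"
      using \<open>S \<noteq> {}\<close> lower[OF p(1), of t0] fin by (intro cInf_greatest) (auto simp: t0_def)
    moreover have "Inf S < t0" using p(2) fin ne by (auto simp: t0_def)
    ultimately show False by simp
  qed
  then obtain q where q: "set_pmf q \<subseteq> B" "\<And>a. a \<in> A \<Longrightarrow> measure_pmf.expectation q (M a) \<le> Inf S"
    unfolding S_def by auto
  have "\<exists>p. set_pmf p \<subseteq> A \<and> (\<forall>b\<in>B. t < measure_pmf.expectation p (\<lambda>a. M a b))" if "t < Inf S" for t
  proof -
    have "t \<notin> S" using that cInf_lower[OF _ bdd] by force
    with alt show ?thesis by blast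
  qed
  with q show ?thesis by (rule that)
qed

theorem matrix_value_exists:
  fixes M :: "'a \<Rightarrow> 'b \<Rightarrow> real"
  assumes fin: "finite A" "finite B" and ne: "A \<noteq> {}" "B \<noteq> {}"
  shows "\<exists>v. is_matrix_value A B M v"
proof -
  obtain v q where q: "set_pmf q \<subseteq> B" "\<And>a. a \<in> A \<Longrightarrow> measure_pmf.expectation q (M a) \<le> v"
    and below: "\<And>t. t < v \<Longrightarrow> \<exists>p. set_pmf p \<subseteq> A \<and> (\<forall>b\<in>B. t < measure_pmf.expectation p (\<lambda>a. M a b))"
    by (rule column_optimum_exists[OF fin ne, of M], rule that)
  obtain v' p where p: "set_pmf p \<subseteq> A" "\<And>b. b \<in> B \<Longrightarrow> measure_pmf.expectation p (\<lambda>a. - M a b) \<le> v'"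
    and below': "\<And>t. t < v' \<Longrightarrow> \<exists>q. set_pmf q \<subseteq> B \<and> (\<forall>a\<in>A. t < measure_pmf.expectation q (\<lambda>b. - M a b))"
    by (rule column_optimum_exists[OF fin(2,1) ne(2,1), of "\<lambda>b a. - M a b"], rule that)
  have "v \<le> - v'"
  proof (rule ccontr)
    assume "\<not> v \<le> - v'"
    then obtain t where t: "- v' < t" "t < v" by (metis dense not_le)
    obtain p' where p': "set_pmf p' \<subseteq> A" "\<And>b. b \<in> B \<Longrightarrow> t < measure_pmf.expectation p' (\<lambda>a. M a b)"
      using below[OF t(2)] by auto
    have "- t < v'" using t by simp
    from below'[OF this] obtain q' where
      q': "set_pmf q' \<subseteq> B" "\<And>a. a \<in> A \<Longrightarrow> measure_pmf.expectation q' (M a) < t"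
      by auto
    define t1 where "t1 = Min ((\<lambda>b. measure_pmf.expectation p' (\<lambda>a. M a b)) ` B)"
    have "t < t1" using p'(2) fin ne by (auto simp: t1_def)
    moreover have "t1 \<le> t"
      using weak_duality[OF fin p'(1) _ q'(1), where v = t1 and M = M and M' = M and v' = t] q'(2) fin
      by (auto simp: t1_def less_imp_le)
    ultimately show False by simp
  qed
  then have "v \<le> measure_pmf.expectation p (\<lambda>a. M a b)" if "b \<in> B" for b
    using p(2)[OF that] by auto
  then show ?thesis unfolding is_matrix_value_def using p(1) q by (intro exI[of _ v]) auto
qed

lemma is_matrix_value_mono:
  assumes "finite A" "finite B" "is_matrix_value A B M v" "is_matrix_value A B M' v'"
    "\<And>a b. a \<in> A \<Longrightarrow> b \<in> B \<Longrightarrow> M a b \<le> M' a b"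
  shows "v \<le> v'"
proof -
  obtain p where p: "set_pmf p \<subseteq> A" "\<And>b. b \<in> B \<Longrightarrow> v \<le> measure_pmf.expectation p (\<lambda>a. M a b)"
    using assms(3) unfolding is_matrix_value_def by blast
  obtain q where q: "set_pmf q \<subseteq> B" "\<And>a. a \<in> A \<Longrightarrow> measure_pmf.expectation q (M' a) \<le> v'"
    using assms(4) unfolding is_matrix_value_def by blast
  show ?thesis by (rule weak_duality[OF assms(1,2) p q assms(5)])
qed

lemma is_matrix_value_matrix_value:
  assumes fin: "finite A" "finite B" and ne: "A \<noteq> {}" "B \<noteq> {}"
  shows "is_matrix_value A B M (matrix_value A B M)"
proof -
  obtain v where v: "is_matrix_value A B M v" using matrix_value_exists[OF assms] by blast
  moreover have "v' = v" if "is_matrix_value A B M v'" for v'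
    using is_matrix_value_mono[OF fin v that] is_matrix_value_mono[OF fin that v] by simp
  ultimately show ?thesis unfolding matrix_value_def by (rule theI)
qed

lemma matrix_value_unique:
  assumes "finite A" "finite B" "A \<noteq> {}" "B \<noteq> {}" "is_matrix_value A B M v"
  shows "matrix_value A B M = v"
  using is_matrix_value_mono[OF assms(1,2) is_matrix_value_matrix_value[OF assms(1-4)] assms(5)]
    is_matrix_value_mono[OF assms(1,2) assms(5) is_matrix_value_matrix_value[OF assms(1-4)]]
  by (intro antisym) simp_all

lemma is_matrix_value_affine:
  assumes fin: "finite A" "finite B" and v: "is_matrix_value A B M v" and \<alpha>: "\<alpha> \<ge> 0"
  shows "is_matrix_value A B (\<lambda>a b. \<alpha> * M a b + \<beta>) (\<alpha> * v + \<beta>)"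
proof -
  obtain p q where pq: "set_pmf p \<subseteq> A" "\<forall>b\<in>B. v \<le> measure_pmf.expectation p (\<lambda>a. M a b)"
      "set_pmf q \<subseteq> B" "\<forall>a\<in>A. measure_pmf.expectation q (M a) \<le> v"
    using v unfolding is_matrix_value_def by blast
  have "finite (set_pmf p)" "finite (set_pmf q)"
    using pq fin by (auto intro: finite_subset)
  with pq show ?thesis unfolding is_matrix_value_def
    using \<alpha> by (intro conjI exI[of _ p] exI[of _ q])
      (auto simp: expectation_affine_finite_support intro: mult_left_mono)
qed

section \<open>Plays and one-stage guarantees\<close>

lemma strategies1_support:
  assumes "\<sigma> \<in> strategies1 \<Gamma>"
  shows "set_pmf (\<sigma> h y) \<subseteq> acts1 \<Gamma> y" "is_stochastic_game \<Gamma> \<Longrightarrow> finite (set_pmf (\<sigma> h y))"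
  using assms finite_subset[of "set_pmf (\<sigma> h y)" "acts1 \<Gamma> y"]
  by (auto simp: is_stochastic_game_def strategies1_def)

lemma strategies2_support:
  assumes "\<tau> \<in> strategies2 \<Gamma>"
  shows "set_pmf (\<tau> h y) \<subseteq> acts2 \<Gamma> y" "is_stochastic_game \<Gamma> \<Longrightarrow> finite (set_pmf (\<tau> h y))"
  using assms finite_subset[of "set_pmf (\<tau> h y)" "acts2 \<Gamma> y"]
  by (auto simp: is_stochastic_game_def strategies2_def)

lemma finite_set_trans_prob:
  "is_stochastic_game \<Gamma> \<Longrightarrow> finite (set_pmf (trans_prob \<Gamma> x a b))"
  by (simp add: is_stochastic_game_def)

lemma finite_set_history_pmf:
  assumes "is_stochastic_game \<Gamma>" "\<sigma> \<in> strategies1 \<Gamma>" "\<tau> \<in> strategies2 \<Gamma>"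
  shows "finite (set_pmf (history_pmf \<Gamma> x \<sigma> \<tau> n))"
  using assms
  by (induction n) (auto simp: strategies1_support strategies2_support finite_set_trans_prob)

lemma length_history_pmf:
  "(h, y) \<in> set_pmf (history_pmf \<Gamma> x \<sigma> \<tau> n) \<Longrightarrow> length h = n"
  by (induction n arbitrary: h y) auto

text \<open>Backward induction, read forward along the play: with \<open>W k\<close> bounding from below what is
  still to be collected when \<open>k\<close> stages remain, the payoff collected so far plus \<open>W\<close> at the
  current state is a submartingale. The stage payoff \<open>r\<close> is arbitrary, so that \<open>r = - payoff\<close>
  covers the minimising player.\<close>

lemma total_payoff_ge:
  fixes W :: "nat \<Rightarrow> 'x \<Rightarrow> real"
  assumes game: "is_stochastic_game \<Gamma>" and \<sigma>: "\<sigma> \<in> strategies1 \<Gamma>" and \<tau>: "\<tau> \<in> strategies2 \<Gamma>"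
    and step: "\<And>k h x. length h + Suc k = n \<Longrightarrow>
      W (Suc k) x \<le> measure_pmf.expectation (\<sigma> h x) (\<lambda>a. measure_pmf.expectation (\<tau> h x)
        (\<lambda>b. r x a b + measure_pmf.expectation (trans_prob \<Gamma> x a b) (W k)))"
  shows "W n x\<^sub>1 \<le> measure_pmf.expectation (history_pmf \<Gamma> x\<^sub>1 \<sigma> \<tau> n)
    (\<lambda>(h, y). (\<Sum>(x, a, b)\<leftarrow>h. r x a b) + W 0 y)"
proof -
  let ?P = "history_pmf \<Gamma> x\<^sub>1 \<sigma> \<tau>"
  let ?G = "\<lambda>t (h, y). (\<Sum>(x, a, b)\<leftarrow>h. r x a b) + W (n - t) y"
  note fin = strategies1_support(2)[OF \<sigma> game] strategies2_support(2)[OF \<tau> game]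
  note fint = finite_set_trans_prob[OF game]
  have "W n x\<^sub>1 \<le> measure_pmf.expectation (?P t) (?G t)" if "t \<le> n" for t
    using that
  proof (induction t)
    case (Suc t)
    have one_step: "?G t (h, x) \<le> measure_pmf.expectation (\<sigma> h x) (\<lambda>a. measure_pmf.expectation (\<tau> h x)
        (\<lambda>b. measure_pmf.expectation (trans_prob \<Gamma> x a b) (\<lambda>y. ?G (Suc t) (h @ [(x, a, b)], y))))"
      if "(h, x) \<in> set_pmf (?P t)" for h x
    proof -
      let ?S = "\<Sum>(x, a, b)\<leftarrow>h. r x a b"
      have "length h = t" using length_history_pmf[OF that] .
      then have l: "length h + Suc (n - Suc t) = n" "Suc (n - Suc t) = n - t" using Suc.prems by auto
      have "W (n - t) x \<le> measure_pmf.expectation (\<sigma> h x) (\<lambda>a. measure_pmf.expectation (\<tau> h x)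
        (\<lambda>b. r x a b + measure_pmf.expectation (trans_prob \<Gamma> x a b) (W (n - Suc t))))"
        using step[OF l(1), of x] unfolding l(2) .
      moreover have "measure_pmf.expectation (trans_prob \<Gamma> x a b) (\<lambda>y. ?G (Suc t) (h @ [(x, a, b)], y)) =
          (r x a b + measure_pmf.expectation (trans_prob \<Gamma> x a b) (W (n - Suc t))) + ?S" for a b
        using expectation_add_const[OF fint, where f = "W (n - Suc t)" and c = "?S + r x a b"]
        by (simp add: algebra_simps)
      ultimately show ?thesis
        by (simp only: expectation_add_const[OF fin(1)] expectation_add_const[OF fin(2)] case_prod_conv)
    qed
    have "W n x\<^sub>1 \<le> measure_pmf.expectation (?P t) (?G t)" using Suc by simp
    also have "\<dots> \<le> measure_pmf.expectation (?P t) (\<lambda>(h, x). measure_pmf.expectation (\<sigma> h x)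
        (\<lambda>a. measure_pmf.expectation (\<tau> h x) (\<lambda>b. measure_pmf.expectation (trans_prob \<Gamma> x a b)
          (\<lambda>y. ?G (Suc t) (h @ [(x, a, b)], y)))))"
      using one_step by (intro expectation_mono_finite_support finite_set_history_pmf game \<sigma> \<tau>) auto
    also have "\<dots> = measure_pmf.expectation (?P (Suc t)) (?G (Suc t))"
      by (simp add: case_prod_beta' expectation_bind_finite_support fin fint
          finite_set_history_pmf[OF game \<sigma> \<tau>])
    finally show ?case .
  qed simp
  from this[of n] show ?thesis by simp
qed

lemma expected_sum_payoff:
  assumes "n \<ge> 1"
  shows "measure_pmf.expectation (history_pmf \<Gamma> x \<sigma> \<tau> n) (\<lambda>(h, y). \<Sum>(x, a, b)\<leftarrow>h. payoff \<Gamma> x a b) =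
         real n * mean_payoff \<Gamma> n x \<sigma> \<tau>"
  using assms by (simp add: mean_payoff_def case_prod_beta')

text \<open>It is enough to check the estimate against the pure actions of the opponent, because his mixed
  action is chosen independently. The constant \<open>C\<close> bounds the potential left over after the last
  stage.\<close>

lemma mean_payoff_ge:
  fixes W :: "nat \<Rightarrow> 'x \<Rightarrow> real"
  assumes game: "is_stochastic_game \<Gamma>" and \<sigma>: "\<sigma> \<in> strategies1 \<Gamma>" and \<tau>: "\<tau> \<in> strategies2 \<Gamma>"
    and n: "n \<ge> 1" and W0: "\<And>y. W 0 y \<le> C"
    and step: "\<And>k h x b. length h + Suc k = n \<Longrightarrow> b \<in> acts2 \<Gamma> x \<Longrightarrow>
      W (Suc k) x \<le> measure_pmf.expectation (\<sigma> h x)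
        (\<lambda>a. payoff \<Gamma> x a b + measure_pmf.expectation (trans_prob \<Gamma> x a b) (W k))"
  shows "W n x\<^sub>1 \<le> real n * mean_payoff \<Gamma> n x\<^sub>1 \<sigma> \<tau> + C"
proof -
  note fin = strategies1_support(2)[OF \<sigma> game] strategies2_support(2)[OF \<tau> game]
  let ?P = "history_pmf \<Gamma> x\<^sub>1 \<sigma> \<tau> n"
  have "W n x\<^sub>1 \<le> measure_pmf.expectation ?P (\<lambda>(h, y). (\<Sum>(x, a, b)\<leftarrow>h. payoff \<Gamma> x a b) + W 0 y)"
  proof (rule total_payoff_ge[OF game \<sigma> \<tau>])
    fix k h x assume l: "length (h :: ('x, 'a, 'b) past) + Suc k = n"
    let ?M = "\<lambda>a b. payoff \<Gamma> x a b + measure_pmf.expectation (trans_prob \<Gamma> x a b) (W k)"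
    have "W (Suc k) x \<le> measure_pmf.expectation (\<tau> h x) (\<lambda>b. measure_pmf.expectation (\<sigma> h x) (\<lambda>a. ?M a b))"
      by (intro expectation_ge_const fin step[OF l] subsetD[OF strategies2_support(1)[OF \<tau>]])
    then show "W (Suc k) x \<le> measure_pmf.expectation (\<sigma> h x) (\<lambda>a. measure_pmf.expectation (\<tau> h x) (?M a))"
      by (simp only: expectation_swap_finite_support[OF fin])
  qed
  also have "\<dots> \<le> measure_pmf.expectation ?P (\<lambda>z. (case z of (h, y) \<Rightarrow> \<Sum>(x, a, b)\<leftarrow>h. payoff \<Gamma> x a b) + C)"
    using W0 by (intro expectation_mono_finite_support finite_set_history_pmf game \<sigma> \<tau>) auto
  also have "\<dots> = real n * mean_payoff \<Gamma> n x\<^sub>1 \<sigma> \<tau> + C"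
    by (simp only: expectation_add_const[OF finite_set_history_pmf[OF game \<sigma> \<tau>]]
        expected_sum_payoff[OF n])
  finally show ?thesis .
qed

lemma mean_payoff_le:
  fixes W :: "nat \<Rightarrow> 'x \<Rightarrow> real"
  assumes game: "is_stochastic_game \<Gamma>" and \<sigma>: "\<sigma> \<in> strategies1 \<Gamma>" and \<tau>: "\<tau> \<in> strategies2 \<Gamma>"
    and n: "n \<ge> 1" and W0: "\<And>y. - C \<le> W 0 y"
    and step: "\<And>k h x a. length h + Suc k = n \<Longrightarrow> a \<in> acts1 \<Gamma> x \<Longrightarrow>
      measure_pmf.expectation (\<tau> h x)
        (\<lambda>b. payoff \<Gamma> x a b + measure_pmf.expectation (trans_prob \<Gamma> x a b) (W k)) \<le> W (Suc k) x"
  shows "real n * mean_payoff \<Gamma> n x\<^sub>1 \<sigma> \<tau> \<le> W n x\<^sub>1 + C"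
proof -
  let ?P = "history_pmf \<Gamma> x\<^sub>1 \<sigma> \<tau> n"
  have "- W n x\<^sub>1 \<le> measure_pmf.expectation ?P (\<lambda>(h, y). (\<Sum>(x, a, b)\<leftarrow>h. - payoff \<Gamma> x a b) + - W 0 y)"
  proof (rule total_payoff_ge[OF game \<sigma> \<tau>, where W = "\<lambda>k y. - W k y"])
    fix k h x assume l: "length (h :: ('x, 'a, 'b) past) + Suc k = n"
    let ?M = "\<lambda>a b. payoff \<Gamma> x a b + measure_pmf.expectation (trans_prob \<Gamma> x a b) (W k)"
    have "measure_pmf.expectation (\<sigma> h x) (\<lambda>a. measure_pmf.expectation (\<tau> h x) (?M a))
        \<le> W (Suc k) x"
      by (intro expectation_le_const strategies1_support(2)[OF \<sigma> game] step[OF l]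
          subsetD[OF strategies1_support(1)[OF \<sigma>]])
    moreover have "- payoff \<Gamma> x a b + measure_pmf.expectation (trans_prob \<Gamma> x a b) (\<lambda>y. - W k y) = - ?M a b" for a b
      by simp
    ultimately show "- W (Suc k) x \<le> measure_pmf.expectation (\<sigma> h x) (\<lambda>a. measure_pmf.expectation (\<tau> h x)
        (\<lambda>b. - payoff \<Gamma> x a b + measure_pmf.expectation (trans_prob \<Gamma> x a b) (\<lambda>y. - W k y)))"
      by (simp only: integral_minus neg_le_iff_le)
  qed
  also have "\<dots> \<le> measure_pmf.expectation ?P (\<lambda>z. (- 1) * (case z of (h, y) \<Rightarrow> \<Sum>(x, a, b)\<leftarrow>h. payoff \<Gamma> x a b) + C)"
  proof (intro expectation_mono_finite_support finite_set_history_pmf game \<sigma> \<tau>)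
    fix z :: "('x, 'a, 'b) past \<times> 'x"
    obtain h y where z: "z = (h, y)" by (cases z)
    have "(\<Sum>(x, a, b)\<leftarrow>h. - payoff \<Gamma> x a b) = - (\<Sum>(x, a, b)\<leftarrow>h. payoff \<Gamma> x a b)"
      by (induction h) auto
    then show "(case z of (h, y) \<Rightarrow> (\<Sum>(x, a, b)\<leftarrow>h. - payoff \<Gamma> x a b) + - W 0 y)
        \<le> (- 1) * (case z of (h, y) \<Rightarrow> \<Sum>(x, a, b)\<leftarrow>h. payoff \<Gamma> x a b) + C"
      using W0[of y] z by simp
  qed
  also have "\<dots> = (- 1) * (real n * mean_payoff \<Gamma> n x\<^sub>1 \<sigma> \<tau>) + C"
    by (simp only: expectation_affine_finite_support[OF finite_set_history_pmf[OF game \<sigma> \<tau>]]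
        expected_sum_payoff[OF n])
  finally show ?thesis by simp
qed

text \<open>The stage payoff is a parameter: with \<open>payoff\<close> this is the Shapley operator of the game, and
  with 0 it is the operator that governs active states.\<close>

definition shapley ::
    "('x, 'a, 'b) stochastic_game \<Rightarrow> ('x \<Rightarrow> 'a \<Rightarrow> 'b \<Rightarrow> real) \<Rightarrow> ('x \<Rightarrow> real) \<Rightarrow> 'x \<Rightarrow> real" where
  "shapley \<Gamma> r f x = matrix_value (acts1 \<Gamma> x) (acts2 \<Gamma> x)
     (\<lambda>a b. r x a b + measure_pmf.expectation (trans_prob \<Gamma> x a b) f)"

lemma shapley_is_matrix_value:
  assumes "is_stochastic_game \<Gamma>"
  shows "is_matrix_value (acts1 \<Gamma> x) (acts2 \<Gamma> x)
    (\<lambda>a b. r x a b + measure_pmf.expectation (trans_prob \<Gamma> x a b) f) (shapley \<Gamma> r f x)"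
  unfolding shapley_def using assms
  by (intro is_matrix_value_matrix_value) (auto simp: is_stochastic_game_def)

lemma shapley_optimal1:
  assumes "is_stochastic_game \<Gamma>"
  shows "\<exists>p. \<forall>x. set_pmf (p x) \<subseteq> acts1 \<Gamma> x \<and> (\<forall>b\<in>acts2 \<Gamma> x. shapley \<Gamma> r f x \<le>
    measure_pmf.expectation (p x) (\<lambda>a. r x a b + measure_pmf.expectation (trans_prob \<Gamma> x a b) f))"
  by (rule choice) (use shapley_is_matrix_value[OF assms, of _ r f] in \<open>unfold is_matrix_value_def, blast\<close>)

lemma shapley_optimal2:
  assumes "is_stochastic_game \<Gamma>"
  shows "\<exists>q. \<forall>x. set_pmf (q x) \<subseteq> acts2 \<Gamma> x \<and> (\<forall>a\<in>acts1 \<Gamma> x.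
    measure_pmf.expectation (q x) (\<lambda>b. r x a b + measure_pmf.expectation (trans_prob \<Gamma> x a b) f)
    \<le> shapley \<Gamma> r f x)"
  by (rule choice) (use shapley_is_matrix_value[OF assms, of _ r f] in \<open>unfold is_matrix_value_def, blast\<close>)

section \<open>The n-stage value\<close>

primrec total_value :: "('x, 'a, 'b) stochastic_game \<Rightarrow> nat \<Rightarrow> 'x \<Rightarrow> real" where
  "total_value \<Gamma> 0 = (\<lambda>_. 0)"
| "total_value \<Gamma> (Suc n) = shapley \<Gamma> (payoff \<Gamma>) (total_value \<Gamma> n)"

lemma mean_payoff_bounds:
  assumes game: "is_stochastic_game \<Gamma>" and \<sigma>: "\<sigma> \<in> strategies1 \<Gamma>" and \<tau>: "\<tau> \<in> strategies2 \<Gamma>"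
    and n: "n \<ge> 1"
  shows "- 1 \<le> mean_payoff \<Gamma> n x \<sigma> \<tau>" "mean_payoff \<Gamma> n x \<sigma> \<tau> \<le> 1"
proof -
  have h: "- real (length h) \<le> (\<Sum>(x, a, b)\<leftarrow>h. payoff \<Gamma> x a b) \<and>
      (\<Sum>(x, a, b)\<leftarrow>h. payoff \<Gamma> x a b) \<le> real (length h)" for h
  proof (induction h)
    case (Cons z h)
    obtain y a b where z: "z = (y, a, b)" by (cases z)
    have "payoff \<Gamma> y a b \<in> {-1..1}" using game unfolding is_stochastic_game_def by blast
    with Cons z show ?case by auto
  qed simp
  have "- real n \<le> real n * mean_payoff \<Gamma> n x \<sigma> \<tau>" "real n * mean_payoff \<Gamma> n x \<sigma> \<tau> \<le> real n"
    unfolding expected_sum_payoff[OF n, symmetric]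
    using h length_history_pmf[of _ _ \<Gamma> x \<sigma> \<tau> n]
    by (auto intro!: expectation_ge_const expectation_le_const finite_set_history_pmf[OF game \<sigma> \<tau>])
  then have "real n * (- 1) \<le> real n * mean_payoff \<Gamma> n x \<sigma> \<tau>" "real n * mean_payoff \<Gamma> n x \<sigma> \<tau> \<le> real n * 1"
    by auto
  then show "- 1 \<le> mean_payoff \<Gamma> n x \<sigma> \<tau>" "mean_payoff \<Gamma> n x \<sigma> \<tau> \<le> 1"
    using n by (simp_all only: mult_le_cancel_left_pos of_nat_0_less_iff)
qed

lemma sup_inf_saddle:
  fixes f :: "'s \<Rightarrow> 't \<Rightarrow> real"
  assumes "s \<in> S" "t \<in> T" and bnd: "\<And>s t. s \<in> S \<Longrightarrow> t \<in> T \<Longrightarrow> l \<le> f s t \<and> f s t \<le> r"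
    and "\<And>t. t \<in> T \<Longrightarrow> v \<le> f s t" "\<And>s. s \<in> S \<Longrightarrow> f s t \<le> v"
  shows "(SUP s\<in>S. INF t\<in>T. f s t) = v" "(INF t\<in>T. SUP s\<in>S. f s t) = v"
proof -
  have bb: "bdd_below (f s ` T)" if "s \<in> S" for s
    using bnd that by (intro bdd_belowI[of _ l]) auto
  have ba: "bdd_above ((\<lambda>s. f s t) ` S)" if "t \<in> T" for t
    using bnd that by (intro bdd_aboveI[of _ r]) auto
  have up: "(INF t\<in>T. f s t) \<le> v" if "s \<in> S" for s
    using cINF_lower[OF bb[OF that] assms(2)] assms(5)[OF that] by linarith
  have low: "v \<le> (SUP s\<in>S. f s t)" if "t \<in> T" for t
    using cSUP_upper[OF assms(1) ba[OF that]] assms(4)[OF that] by linarith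
  show "(SUP s\<in>S. INF t\<in>T. f s t) = v"
  proof (rule antisym)
    show "(SUP s\<in>S. INF t\<in>T. f s t) \<le> v" using assms(1) up by (intro cSUP_least) auto
    have "v \<le> (INF t\<in>T. f s t)" using assms(2,4) by (intro cINF_greatest) auto
    also have "\<dots> \<le> (SUP s\<in>S. INF t\<in>T. f s t)"
      using up assms(1) by (intro cSUP_upper bdd_aboveI[of _ v]) auto
    finally show "v \<le> (SUP s\<in>S. INF t\<in>T. f s t)" .
  qed
  show "(INF t\<in>T. SUP s\<in>S. f s t) = v"
  proof (rule antisym)
    show "v \<le> (INF t\<in>T. SUP s\<in>S. f s t)" using assms(2) low by (intro cINF_greatest) auto
    have "(INF t\<in>T. SUP s\<in>S. f s t) \<le> (SUP s\<in>S. f s t)"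
      using low assms(2) by (intro cINF_lower bdd_belowI[of _ v]) auto
    also have "\<dots> \<le> v" using assms(1,5) by (intro cSUP_least) auto
    finally show "(INF t\<in>T. SUP s\<in>S. f s t) \<le> v" .
  qed
qed

text \<open>The optimal strategies are Markovian: with \<open>k\<close> stages to go, play optimally in the matrix game
  whose continuation payoff is the total value of the remaining \<open>k - 1\<close> stages.\<close>

theorem n_stage_value_eq:
  assumes game: "is_stochastic_game \<Gamma>" and n: "n \<ge> 1"
  shows "n_stage_value \<Gamma> n x = total_value \<Gamma> n x / real n"
proof -
  let ?W = "total_value \<Gamma>"
  let ?M = "\<lambda>k x a b. payoff \<Gamma> x a b + measure_pmf.expectation (trans_prob \<Gamma> x a b) (?W k)"
  have "\<forall>k. \<exists>p. \<forall>x. set_pmf (p x) \<subseteq> acts1 \<Gamma> x \<and>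
      (\<forall>b\<in>acts2 \<Gamma> x. ?W (Suc k) x \<le> measure_pmf.expectation (p x) (\<lambda>a. ?M k x a b))"
    using shapley_optimal1[OF game, of "payoff \<Gamma>"] by simp
  from choice[OF this] obtain p where p: "\<And>k x. set_pmf (p k x) \<subseteq> acts1 \<Gamma> x"
    "\<And>k x b. b \<in> acts2 \<Gamma> x \<Longrightarrow> ?W (Suc k) x \<le> measure_pmf.expectation (p k x) (\<lambda>a. ?M k x a b)"
    by blast
  have "\<forall>k. \<exists>q. \<forall>x. set_pmf (q x) \<subseteq> acts2 \<Gamma> x \<and>
      (\<forall>a\<in>acts1 \<Gamma> x. measure_pmf.expectation (q x) (?M k x a) \<le> ?W (Suc k) x)"
    using shapley_optimal2[OF game, of "payoff \<Gamma>"] by simp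
  from choice[OF this] obtain q where q: "\<And>k x. set_pmf (q k x) \<subseteq> acts2 \<Gamma> x"
    "\<And>k x a. a \<in> acts1 \<Gamma> x \<Longrightarrow> measure_pmf.expectation (q k x) (?M k x a) \<le> ?W (Suc k) x"
    by blast
  define \<sigma> :: "('a, 'b, 'c, 'b) strategy" where "\<sigma> h y = p (n - Suc (length h)) y" for h y
  define \<tau> :: "('a, 'b, 'c, 'c) strategy" where "\<tau> h y = q (n - Suc (length h)) y" for h y
  have \<sigma>: "\<sigma> \<in> strategies1 \<Gamma>" using p(1) by (auto simp: strategies1_def \<sigma>_def)
  have \<tau>: "\<tau> \<in> strategies2 \<Gamma>" using q(1) by (auto simp: strategies2_def \<tau>_def)
  have low: "?W n x / real n \<le> mean_payoff \<Gamma> n x \<sigma> \<tau>'" if "\<tau>' \<in> strategies2 \<Gamma>" for \<tau>'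
  proof -
    have "?W n x \<le> real n * mean_payoff \<Gamma> n x \<sigma> \<tau>' + 0"
      by (rule mean_payoff_ge[OF game \<sigma> that n]) (auto simp: \<sigma>_def intro: p(2)[unfolded total_value.simps(2)])
    then show ?thesis using n by (simp add: field_simps)
  qed
  have up: "mean_payoff \<Gamma> n x \<sigma>' \<tau> \<le> ?W n x / real n" if "\<sigma>' \<in> strategies1 \<Gamma>" for \<sigma>'
  proof -
    have "real n * mean_payoff \<Gamma> n x \<sigma>' \<tau> \<le> ?W n x + 0"
      by (rule mean_payoff_le[OF game that \<tau> n]) (auto simp: \<tau>_def intro: q(2)[unfolded total_value.simps(2)])
    then show ?thesis using n by (simp add: field_simps)
  qed
  have "- 1 \<le> mean_payoff \<Gamma> n x \<sigma>' \<tau>' \<and> mean_payoff \<Gamma> n x \<sigma>' \<tau>' \<le> 1"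
    if "\<sigma>' \<in> strategies1 \<Gamma>" "\<tau>' \<in> strategies2 \<Gamma>" for \<sigma>' \<tau>'
    using mean_payoff_bounds[OF game that n] by simp
  note saddle = sup_inf_saddle[where f = "mean_payoff \<Gamma> n x", OF \<sigma> \<tau> this low up]
  have "is_n_stage_value \<Gamma> n x v \<longleftrightarrow> v = ?W n x / real n" for v
    unfolding is_n_stage_value_def using saddle by simp
  then show ?thesis unfolding n_stage_value_def by (intro the_equality) auto
qed

section \<open>A potential above the upper limit of the values\<close>

text \<open>The theory below is used twice: for player 1 with the one-shot value operator and the values,
  and for player 2 with \<open>f \<mapsto> - T (- f)\<close> and the negated values.\<close>

locale value_iteration =
  fixes T :: "('x \<Rightarrow> real) \<Rightarrow> 'x \<Rightarrow> real" and V :: "nat \<Rightarrow> 'x \<Rightarrow> real" and X0 :: "'x set"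
  assumes T_mono: "(\<And>y. f y \<le> g y) \<Longrightarrow> T f x \<le> T g x"
    and T_affine: "\<alpha> \<ge> 0 \<Longrightarrow> T (\<lambda>y. \<alpha> * f y + \<beta>) x = \<alpha> * T f x + \<beta>"
    and V_bounds: "n \<ge> 1 \<Longrightarrow> - 1 \<le> V n x \<and> V n x \<le> 1"
    and V_Suc: "n \<ge> 1 \<Longrightarrow> x \<in> X0 \<Longrightarrow> real (Suc n) * V (Suc n) x = real n * T (V n) x"
    and recurrent_nets: "\<delta> > 0 \<Longrightarrow> \<exists>N\<ge>1. \<forall>K. \<exists>J. finite J \<and> J \<subseteq> {K..} \<and>
      (\<forall>n\<ge>N. \<exists>j\<in>J. \<forall>x. \<bar>V n x - V j x\<bar> \<le> \<delta>)"
begin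

definition upper_limit :: "'x \<Rightarrow> real" where
  "upper_limit x = (INF n\<in>{1..}. SUP m\<in>{n..}. V m x)"

lemma bdd_above_tail: "n \<ge> 1 \<Longrightarrow> bdd_above ((\<lambda>m. V m x) ` {n..})"
  using V_bounds by (intro bdd_aboveI[of _ 1]) auto

lemma tail_sup_bounds:
  assumes "n \<ge> 1"
  shows "- 1 \<le> (SUP m\<in>{n..}. V m x)" "(SUP m\<in>{n..}. V m x) \<le> 1"
proof -
  have "V n x \<le> (SUP m\<in>{n..}. V m x)" using assms by (intro cSUP_upper bdd_above_tail) auto
  then show "- 1 \<le> (SUP m\<in>{n..}. V m x)" using V_bounds[OF assms, of x] by linarith
  show "(SUP m\<in>{n..}. V m x) \<le> 1" using assms V_bounds by (intro cSUP_least) auto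
qed

lemma bdd_below_tail_sup: "bdd_below ((\<lambda>n. SUP m\<in>{n..}. V m x) ` {1..})"
  using tail_sup_bounds by (intro bdd_belowI[of _ "- 1"]) auto

lemma upper_limit_bounds: "- 1 \<le> upper_limit x" "upper_limit x \<le> 1"
proof -
  show "- 1 \<le> upper_limit x"
    unfolding upper_limit_def by (intro cINF_greatest tail_sup_bounds) auto
  have "upper_limit x \<le> (SUP m\<in>{1..}. V m x)"
    unfolding upper_limit_def by (intro cINF_lower bdd_below_tail_sup) auto
  then show "upper_limit x \<le> 1" using tail_sup_bounds(2)[of 1 x] by linarith
qed

lemma upper_limit_const:
  assumes "\<And>n. n \<ge> 1 \<Longrightarrow> V n x = c"
  shows "upper_limit x = c"
proof -
  have "(\<lambda>m. V m x) ` {n..} = {c}" if "n \<ge> 1" for n using assms that by force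
  then have "(\<lambda>n. SUP m\<in>{n..}. V m x) ` {1..} = {c}" by force
  then show ?thesis unfolding upper_limit_def by simp
qed

lemma upper_limit_frequently:
  assumes "\<delta> > 0"
  shows "\<exists>n\<ge>K. n \<ge> 1 \<and> upper_limit x - \<delta> < V n x"
proof -
  have "upper_limit x \<le> (SUP m\<in>{max 1 K..}. V m x)"
    unfolding upper_limit_def by (intro cINF_lower bdd_below_tail_sup) auto
  then have "upper_limit x - \<delta> < (SUP m\<in>{max 1 K..}. V m x)" using assms by linarith
  then obtain n where "n \<in> {max 1 K..}" "upper_limit x - \<delta> < V n x"
    by (subst (asm) less_cSUP_iff) (auto intro: bdd_above_tail)
  then show ?thesis by auto
qed

text \<open>At a single state, any number above a limsup is eventually an upper bound. That this happens at
  the same time for all states comes from recurrence: each late value function is uniformly close to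
  arbitrarily late ones.\<close>

lemma upper_limit_eventually:
  assumes "\<delta> > 0"
  shows "\<exists>N\<ge>1. \<forall>n\<ge>N. \<forall>x. V n x \<le> upper_limit x + \<delta>"
proof -
  obtain N where N: "N \<ge> 1" and nets: "\<And>K. \<exists>J. finite J \<and> J \<subseteq> {K..} \<and>
      (\<forall>n\<ge>N. \<exists>j\<in>J. \<forall>x. \<bar>V n x - V j x\<bar> \<le> \<delta>)"
    using recurrent_nets[OF assms] by blast
  have "V n x \<le> upper_limit x + \<delta>" if "n \<ge> N" for n x
  proof -
    have "V n x - \<delta> \<le> (SUP m\<in>{K..}. V m x)" if "K \<in> {1..}" for K
    proof -
      obtain j where "j \<ge> K" and j: "\<forall>x. \<bar>V n x - V j x\<bar> \<le> \<delta>"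
        using nets[of K] \<open>n \<ge> N\<close> by (meson atLeast_iff subsetD)
      then have "V j x \<le> (SUP m\<in>{K..}. V m x)"
        using that by (intro cSUP_upper bdd_above_tail) auto
      moreover have "\<bar>V n x - V j x\<bar> \<le> \<delta>" using j by blast
      ultimately show ?thesis by linarith
    qed
    then have "V n x - \<delta> \<le> upper_limit x" unfolding upper_limit_def by (intro cINF_greatest) auto
    then show ?thesis by linarith
  qed
  with N show ?thesis by blast
qed

text \<open>The limit passes through \<open>T\<close> in this direction because late values exceed the upper limit only
  by a uniformly small amount.\<close>

lemma upper_limit_subharmonic:
  assumes x: "x \<in> X0"
  shows "upper_limit x \<le> T upper_limit x"
proof (rule field_le_epsilon)
  fix e :: real assume e: "e > 0"
  have Tu: "T upper_limit x \<ge> - 1"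
    using T_mono[of "\<lambda>y. 0 * upper_limit y + - 1" upper_limit x] T_affine[of 0 upper_limit "- 1" x]
      upper_limit_bounds(1) by simp
  obtain N where N: "N \<ge> 1" "\<And>n y. n \<ge> N \<Longrightarrow> V n y \<le> upper_limit y + e / 3"
    using upper_limit_eventually[of "e / 3"] e by auto
  obtain M :: nat where M: "3 / e \<le> real M" using real_arch_simple by blast
  obtain n where n: "n \<ge> Suc (max N M)" "upper_limit x - e / 3 < V n x"
    using upper_limit_frequently[of "e / 3" "Suc (max N M)" x] e by auto
  then obtain k where k: "n = Suc k" "k \<ge> N" "k \<ge> M" by (cases n) auto
  have "T (V k) x \<le> T (\<lambda>y. 1 * upper_limit y + e / 3) x" using N k by (intro T_mono) auto
  also have "\<dots> = T upper_limit x + e / 3" by (subst T_affine) auto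
  finally have "real k * T (V k) x \<le> real k * (T upper_limit x + e / 3)" by (intro mult_left_mono) auto
  then have "real (Suc k) * V n x \<le> real k * (T upper_limit x + e / 3)"
    using V_Suc[of k x] x k N by simp
  also have "\<dots> \<le> real (Suc k) * (T upper_limit x + e / 3) + 1"
  proof -
    have "real (Suc k) * (T upper_limit x + e / 3) = real k * (T upper_limit x + e / 3) + (T upper_limit x + e / 3)"
      by (simp add: algebra_simps)
    then show ?thesis using Tu e by linarith
  qed
  also have "1 \<le> real (Suc k) * (e / 3)"
  proof -
    have "3 / e \<le> real (Suc k)" using M k by simp
    then show ?thesis using e by (simp add: field_simps)
  qed
  finally have "real (Suc k) * V n x \<le> real (Suc k) * (T upper_limit x + e / 3 + e / 3)"
    by (simp add: algebra_simps)
  then have "V n x \<le> T upper_limit x + e / 3 + e / 3"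
    by (simp only: mult_le_cancel_left_pos of_nat_0_less_iff zero_less_Suc)
  then show "upper_limit x \<le> T upper_limit x + e" using n by linarith
qed

text \<open>This is the heart of the proof. On active states the recursion reads
  \<open>T (V (m - 1)) = (1 + 1 / (m - 1)) * V m\<close>: counting \<open>m\<close> down is a strict gain where \<open>V m\<close> is
  positive. A countdown from \<open>j\<close> to the smallest admissible index \<open>N\<close>, at most half of \<open>j\<close>, can
  therefore bear the growing fee \<open>\<eta> * (1 - m / j)\<close>. By the time \<open>N\<close> is reached the fee is at least
  \<open>\<eta> / 2\<close>, and waiving it pays for a jump to the start \<open>i\<close> of another countdown with \<open>V i\<close> within \<open>\<delta>\<close>
  of \<open>V N\<close>. The factor \<open>1 + \<kappa>\<close> and the constant \<open>\<kappa> * \<theta>\<close> tilt the countdown functions against the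
  upper limit: one of them can exceed it only where its \<open>V m\<close> is at least \<open>\<theta> / 2\<close>, and one of them
  does exceed it wherever it is greater than \<open>\<epsilon> = 3 * \<theta>\<close>. The pointwise maximum \<open>\<Phi>\<close> inherits the gain
  of whichever function attains it.\<close>

theorem potential_exists:
  assumes \<epsilon>: "0 < \<epsilon>" "\<epsilon> \<le> 1"
  shows "\<exists>\<Phi> c. c > 0 \<and> (\<forall>x. upper_limit x \<le> \<Phi> x \<and> \<Phi> x \<le> upper_limit x + \<epsilon>) \<and>
    (\<forall>x\<in>X0. \<Phi> x \<le> T \<Phi> x \<and> (\<epsilon> < upper_limit x \<longrightarrow> \<Phi> x + c \<le> T \<Phi> x))"
proof -
  \<comment> \<open>The error \<open>\<delta>\<close> has to be small compared with the effect \<open>\<kappa> * \<theta>\<close> of the tilt, which is of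
    second order in \<open>\<epsilon>\<close>.\<close>
  define \<kappa> \<theta> \<eta> \<delta> where "\<kappa> = \<epsilon> / 2" and "\<theta> = \<epsilon> / 3" and "\<eta> = \<epsilon> / 12" and "\<delta> = \<epsilon>\<^sup>2 / 100"
  have \<delta>0: "\<delta> > 0" using \<epsilon> by (simp add: \<delta>_def)
  have "\<epsilon>\<^sup>2 \<le> \<epsilon>" using \<epsilon> by (simp add: power2_eq_square mult_left_le)
  then have \<delta>\<epsilon>: "\<delta> \<le> \<epsilon> / 100" by (simp add: \<delta>_def)
  have \<kappa>01: "0 < \<kappa>" "\<kappa> \<le> 1" using \<epsilon> by (auto simp: \<kappa>_def)
  obtain N1 where N1: "N1 \<ge> 1" "\<And>K. \<exists>J. finite J \<and> J \<subseteq> {K..} \<and>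
      (\<forall>n\<ge>N1. \<exists>j\<in>J. \<forall>x. \<bar>V n x - V j x\<bar> \<le> \<delta>)"
    using recurrent_nets[OF \<delta>0] by blast
  obtain N2 where N2: "N2 \<ge> 1" "\<And>n x. n \<ge> N2 \<Longrightarrow> V n x \<le> upper_limit x + \<delta>"
    using upper_limit_eventually[OF \<delta>0] by blast
  define N where "N = max N1 N2"
  have N: "N \<ge> 1" "N \<ge> N1" "N \<ge> N2" using N1(1) by (auto simp: N_def)
  obtain J where J: "finite J" "J \<subseteq> {2 * N..}"
    and J_net: "\<And>n. n \<ge> N1 \<Longrightarrow> \<exists>j\<in>J. \<forall>x. \<bar>V n x - V j x\<bar> \<le> \<delta>"
    using N1(2)[of "2 * N"] by blast
  have jump: "\<exists>i\<in>J. V m x \<le> V i x + \<delta>" if m: "m \<ge> N" for m x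
  proof -
    obtain i where i: "i \<in> J" "\<forall>x. \<bar>V m x - V i x\<bar> \<le> \<delta>"
      using J_net[of m] N m by (meson le_trans)
    have "V m x \<le> V i x + \<delta>" using spec[OF i(2), of x] by linarith
    with i(1) show ?thesis by blast
  qed
  have start: "\<exists>i\<in>J. upper_limit x \<le> V i x + 2 * \<delta>" for x
  proof -
    obtain n where "n \<ge> N" "upper_limit x - \<delta> < V n x"
      using upper_limit_frequently[OF \<delta>0, of N x] by auto
    moreover obtain i where "i \<in> J" "V n x \<le> V i x + \<delta>" using jump[OF \<open>n \<ge> N\<close>] by blast
    ultimately show ?thesis by (intro bexI[of _ i]) auto
  qed
  have J2: "2 * N \<le> j" "real j > 0" if "j \<in> J" for j using J that N by auto
  define \<Psi> where "\<Psi> j m x = (1 + \<kappa>) * V m x - \<kappa> * \<theta> - \<eta> * (1 - real m / real j)" for j m x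
  define I where "I = Sigma J (\<lambda>j. {N..j})"
  define cand where "cand x = insert (upper_limit x) ((\<lambda>(j, m). \<Psi> j m x) ` I)" for x
  define \<Phi> where "\<Phi> x = Max (cand x)" for x
  have "finite I" using J by (simp add: I_def)
  then have fin: "finite (cand x)" for x by (simp add: cand_def)
  have \<Phi>_u: "upper_limit x \<le> \<Phi> x" for x
    unfolding \<Phi>_def using fin by (intro Max_ge) (auto simp: cand_def)
  have \<Phi>_\<Psi>: "\<Psi> j m x \<le> \<Phi> x" if "j \<in> J" "N \<le> m" "m \<le> j" for j m x
    unfolding \<Phi>_def using that by (intro Max_ge fin) (force simp: cand_def I_def)
  have fee: "0 \<le> \<eta> * (1 - real m / real j)" if "m \<le> j" for m j
    using that \<epsilon> by (intro mult_nonneg_nonneg) (auto simp: \<eta>_def divide_le_eq_1)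
  have \<Phi>_le: "\<Phi> x \<le> upper_limit x + \<epsilon>" for x
  proof -
    have "\<Psi> j m x \<le> upper_limit x + \<epsilon>" if jm: "j \<in> J" "N \<le> m" "m \<le> j" for j m
    proof -
      have "(1 + \<kappa>) * V m x \<le> (1 + \<kappa>) * (upper_limit x + \<delta>)"
        using N2(2)[of m x] jm N \<kappa>01 by (intro mult_left_mono) auto
      also have "\<dots> = upper_limit x + \<kappa> * upper_limit x + (1 + \<kappa>) * \<delta>" by (simp add: algebra_simps)
      also have "\<kappa> * upper_limit x \<le> \<kappa> * 1" using \<kappa>01 upper_limit_bounds by (intro mult_left_mono) auto
      also have "(1 + \<kappa>) * \<delta> \<le> 2 * \<delta>" using \<kappa>01 \<delta>0 by (intro mult_right_mono) auto
      finally have "(1 + \<kappa>) * V m x \<le> upper_limit x + \<kappa> + 2 * \<delta>" by simp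
      moreover have "0 \<le> \<kappa> * \<theta>" using \<epsilon> by (simp add: \<kappa>_def \<theta>_def)
      moreover have "\<kappa> + 2 * \<delta> \<le> \<epsilon>" using \<delta>\<epsilon> \<epsilon> by (simp add: \<kappa>_def)
      ultimately show ?thesis using fee[OF jm(3)] unfolding \<Psi>_def by linarith
    qed
    then show ?thesis unfolding \<Phi>_def using fin \<epsilon> by (subst Max_le_iff) (auto simp: cand_def I_def)
  qed
  define c where "c = \<epsilon> / (12 * real (Max J))"
  have "J \<noteq> {}" using start by auto
  have c: "0 < c" "c \<le> \<epsilon> / 12 / real j" if "j \<in> J" for j
  proof -
    have "real j \<le> real (Max J)" using J(1) that by simp
    moreover have "0 < real j" using J2[OF that] by simp
    ultimately show "0 < c" "c \<le> \<epsilon> / 12 / real j"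
      using \<epsilon> by (auto simp: c_def divide_divide_eq_left intro!: divide_left_mono mult_pos_pos divide_pos_pos)
  qed
  have "\<Phi> x \<le> T \<Phi> x \<and> (\<epsilon> < upper_limit x \<longrightarrow> \<Phi> x + c \<le> T \<Phi> x)" if x: "x \<in> X0" for x
  proof -
    have "\<Phi> x \<in> cand x" unfolding \<Phi>_def using fin by (intro Max_in) (auto simp: cand_def)
    then consider (low) "\<Phi> x = upper_limit x"
      | (high) j m where "j \<in> J" "N \<le> m" "m \<le> j" "\<Phi> x = \<Psi> j m x"
      by (auto simp: cand_def I_def)
    then show ?thesis
    proof cases
      case low
      \<comment> \<open>Otherwise the start of a countdown from a value close to the upper limit would lie above it.\<close>
      have "\<not> \<epsilon> < upper_limit x"
      proof
        assume above: "\<epsilon> < upper_limit x"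
        obtain i where i: "i \<in> J" "upper_limit x \<le> V i x + 2 * \<delta>" using start by blast
        have "\<Psi> i i x \<le> upper_limit x" using \<Phi>_\<Psi>[of i i x] J2[OF i(1)] i low by auto
        then have "\<kappa> * (V i x - \<theta>) \<le> 2 * \<delta>" using i J2[OF i(1)] by (simp add: \<Psi>_def algebra_simps)
        moreover have "\<epsilon> / 2 \<le> V i x - \<theta>" using i above \<delta>\<epsilon> \<epsilon> by (simp add: \<theta>_def)
        then have "\<kappa> * (\<epsilon> / 2) \<le> \<kappa> * (V i x - \<theta>)" using \<kappa>01 by (intro mult_left_mono) auto
        moreover have "\<kappa> * (\<epsilon> / 2) = 25 * \<delta>" by (simp add: \<kappa>_def \<delta>_def power2_eq_square)
        ultimately show False using \<delta>0 by linarith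
      qed
      moreover have "\<Phi> x \<le> T \<Phi> x"
        using upper_limit_subharmonic[OF x] T_mono[of upper_limit \<Phi> x] \<Phi>_u low by force
      ultimately show ?thesis by blast
    next
      case high
      have V_pos: "\<theta> / 2 \<le> V m x"
      proof (rule ccontr)
        assume "\<not> \<theta> / 2 \<le> V m x"
        then have "\<kappa> * (V m x - \<theta>) \<le> \<kappa> * (- \<theta> / 2)" using \<kappa>01 by (intro mult_left_mono) auto
        moreover have "\<kappa> * (- \<theta> / 2) = - (25 / 3) * \<delta>" by (simp add: \<kappa>_def \<delta>_def \<theta>_def power2_eq_square)
        moreover have "V m x \<le> \<Psi> j m x + \<delta>" using \<Phi>_u[of x] N2(2)[of m x] N high by auto
        then have "- \<delta> \<le> \<kappa> * (V m x - \<theta>)"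
          using fee[OF high(3)] unfolding \<Psi>_def by (simp add: algebra_simps)
        ultimately show False using \<delta>0 by linarith
      qed
      \<comment> \<open>At the end of a countdown the start of another one is higher.\<close>
      have "m \<noteq> N"
      proof
        assume m: "m = N"
        obtain i where i: "i \<in> J" "V N x \<le> V i x + \<delta>" using jump by blast
        have "\<Psi> i i x \<le> \<Psi> j N x" using \<Phi>_\<Psi>[of i i x] J2[OF i(1)] i high m by auto
        then have "(1 + \<kappa>) * V i x \<le> (1 + \<kappa>) * V N x - \<eta> * (1 - real N / real j)"
          using J2[OF i(1)] by (simp add: \<Psi>_def)
        also have "(1 + \<kappa>) * V N x \<le> (1 + \<kappa>) * (V i x + \<delta>)" using i \<kappa>01 by (intro mult_left_mono) auto
        finally have "\<eta> * (1 - real N / real j) \<le> (1 + \<kappa>) * \<delta>" by (simp add: algebra_simps)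
        also have "\<dots> \<le> 2 * \<delta>" using \<kappa>01 \<delta>0 by (intro mult_right_mono) auto
        finally have "\<eta> * (1 - real N / real j) \<le> 2 * \<delta>" .
        moreover have "real N / real j \<le> 1 / 2" using J2[OF high(1)] by (simp add: field_simps)
        then have "\<eta> * (1 / 2) \<le> \<eta> * (1 - real N / real j)"
          using \<epsilon> by (intro mult_left_mono) (auto simp: \<eta>_def)
        moreover have "\<eta> * (1 / 2) = \<epsilon> / 24" by (simp add: \<eta>_def)
        ultimately show False using \<delta>\<epsilon> \<epsilon> by linarith
      qed
      then obtain k where k: "m = Suc k" "k \<ge> N" using high by (cases m) auto
      have k0: "real k > 0" "real k \<le> real j" "k \<ge> 1" using k N high by auto
      have "T (V k) x = V m x + V m x / real k"
        using V_Suc[OF k0(3) x] k k0(1) by (simp add: field_simps)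
      then have "T (\<Psi> j k) x = (1 + \<kappa>) * (V m x + V m x / real k) - \<kappa> * \<theta> - \<eta> * (1 - real k / real j)"
        using T_affine[of "1 + \<kappa>" "V k" "- \<kappa> * \<theta> - \<eta> * (1 - real k / real j)" x] \<kappa>01
        by (simp add: \<Psi>_def[abs_def] algebra_simps)
      also have "\<dots> = \<Psi> j m x + (1 + \<kappa>) * (V m x / real k) - \<eta> / real j"
        using k k0 by (simp add: \<Psi>_def field_simps)
      finally have T\<Psi>: "T (\<Psi> j k) x = \<Psi> j m x + (1 + \<kappa>) * (V m x / real k) - \<eta> / real j" .
      have "\<theta> / 2 / real j \<le> V m x / real k"
        using V_pos k0 \<epsilon> by (intro frac_le) (auto simp: \<theta>_def)
      also have "\<dots> \<le> (1 + \<kappa>) * (V m x / real k)"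
      proof -
        have "0 \<le> V m x / real k" using V_pos k0 \<epsilon> by (auto simp: \<theta>_def)
        then show ?thesis using mult_right_mono[of 1 "1 + \<kappa>" "V m x / real k"] \<kappa>01 by simp
      qed
      finally have "\<Psi> j m x + (\<theta> / 2 / real j - \<eta> / real j) \<le> T (\<Psi> j k) x" using T\<Psi> by linarith
      moreover have "\<theta> / 2 / real j - \<eta> / real j = \<epsilon> / 12 / real j"
        by (simp add: \<theta>_def \<eta>_def field_simps)
      moreover have "T (\<Psi> j k) x \<le> T \<Phi> x"
        using high k by (intro T_mono \<Phi>_\<Psi>) auto
      ultimately have "\<Phi> x + c \<le> T \<Phi> x" using high c(2)[OF high(1)] by linarith
      then show ?thesis using c(1)[OF high(1)] by auto
    qed
  qed
  moreover have "c > 0" using \<open>J \<noteq> {}\<close> c by blast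
  ultimately show ?thesis using \<Phi>_u \<Phi>_le by blast
qed

end

section \<open>Stationary strategies from a potential\<close>

abbreviation no_payoff :: "'x \<Rightarrow> 'a \<Rightarrow> 'b \<Rightarrow> real" where
  "no_payoff \<equiv> \<lambda>_ _ _. 0"

lemma expectation_absorbing:
  fixes f :: "'x \<Rightarrow> real"
  assumes "pmf (trans_prob \<Gamma> x a b) x = 1"
  shows "measure_pmf.expectation (trans_prob \<Gamma> x a b) f = f x"
proof -
  have "trans_prob \<Gamma> x a b = return_pmf x"
  proof (rule ccontr)
    assume "trans_prob \<Gamma> x a b \<noteq> return_pmf x"
    then obtain z where "pmf (trans_prob \<Gamma> x a b) z < pmf (return_pmf x) z"
      using pmf_neq_exists_less by blast
    with assms pmf_nonneg[of "trans_prob \<Gamma> x a b" z] show False by (cases "z = x") auto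
  qed
  then show ?thesis by simp
qed

text \<open>The potential is put, with the weight \<open>k + 1 / c\<close>, in place of the continuation value when
  \<open>k\<close> stages remain. The \<open>k\<close> copies account for the stage payoffs, which match the potential up
  to \<open>2 * \<epsilon>\<close> except at active states where \<open>u\<close> exceeds \<open>\<epsilon>\<close>; there the extra weight \<open>1 / c\<close> turns
  the gain \<open>c\<close> into a credit of 1, which covers the missing stage payoff.\<close>

lemma weighted_potential_step:
  fixes f t e c k :: real
  assumes "c > 0" "k \<ge> 0" "f \<le> t" "f \<le> 1 + e" "e \<ge> 0" and "f \<le> 2 * e \<or> f + c \<le> t"
  shows "(k + 1 + 1 / c) * f - 2 * e * (k + 1) \<le> (k + 1 / c) * t - 2 * e * k"
proof -
  have "f - 2 * e \<le> (k + 1 / c) * (t - f)"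
    using assms(6)
  proof
    assume "f \<le> 2 * e"
    moreover have "0 \<le> (k + 1 / c) * (t - f)" using assms by (intro mult_nonneg_nonneg) auto
    ultimately show ?thesis by linarith
  next
    assume "f + c \<le> t"
    then have "1 / c * c \<le> (k + 1 / c) * (t - f)" using assms by (intro mult_mono) auto
    then show ?thesis using assms by simp
  qed
  then show ?thesis by (simp add: algebra_simps diff_divide_distrib)
qed

lemma player1_guarantees:
  fixes u :: "'x \<Rightarrow> real"
  assumes rec: "recursive_game \<Gamma> X0"
    and u: "\<And>x. - 1 \<le> u x \<and> u x \<le> 1"
    and absorbing: "\<And>x a b. x \<notin> X0 \<Longrightarrow> a \<in> acts1 \<Gamma> x \<Longrightarrow> b \<in> acts2 \<Gamma> x \<Longrightarrow> payoff \<Gamma> x a b = u x"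
    and potential: "\<And>\<epsilon>. 0 < \<epsilon> \<Longrightarrow> \<epsilon> \<le> 1 \<Longrightarrow> \<exists>\<Phi> c. c > 0 \<and> (\<forall>x. u x \<le> \<Phi> x \<and> \<Phi> x \<le> u x + \<epsilon>) \<and>
      (\<forall>x\<in>X0. \<Phi> x \<le> shapley \<Gamma> no_payoff \<Phi> x \<and>
        (\<epsilon> < u x \<longrightarrow> \<Phi> x + c \<le> shapley \<Gamma> no_payoff \<Phi> x))"
  shows "uniformly_guarantees1 \<Gamma> X0 state_history_strategies u"
  unfolding uniformly_guarantees1_def
proof (intro allI impI)
  fix \<epsilon> :: real assume "\<epsilon> > 0"
  define e where "e = min 1 (\<epsilon> / 4)"
  have e: "0 < e" "e \<le> 1" "3 * e \<le> \<epsilon>" using \<open>\<epsilon> > 0\<close> by (auto simp: e_def)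
  have game: "is_stochastic_game \<Gamma>" using rec by (simp add: recursive_game_def)
  obtain \<Phi> c where c: "c > 0" and \<Phi>: "\<And>x. u x \<le> \<Phi> x" "\<And>x. \<Phi> x \<le> u x + e"
    and T\<Phi>: "\<And>x. x \<in> X0 \<Longrightarrow> \<Phi> x \<le> shapley \<Gamma> no_payoff \<Phi> x"
      "\<And>x. x \<in> X0 \<Longrightarrow> e < u x \<Longrightarrow> \<Phi> x + c \<le> shapley \<Gamma> no_payoff \<Phi> x"
    using potential[OF e(1,2)] by blast
  obtain p where p: "\<And>x. set_pmf (p x) \<subseteq> acts1 \<Gamma> x" and p_opt: "\<And>x b. b \<in> acts2 \<Gamma> x \<Longrightarrow>
      shapley \<Gamma> no_payoff \<Phi> x \<le>
      measure_pmf.expectation (p x) (\<lambda>a. 0 + measure_pmf.expectation (trans_prob \<Gamma> x a b) \<Phi>)"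
    using shapley_optimal1[OF game, of no_payoff \<Phi>] by blast
  define \<sigma> :: "('x, 'a, 'b, 'a) strategy" where "\<sigma> = (\<lambda>h. p)"
  have \<sigma>: "\<sigma> \<in> strategies1 \<Gamma>" using p by (auto simp: strategies1_def \<sigma>_def)
  have finp: "finite (set_pmf (p x))" for x using strategies1_support(2)[OF \<sigma> game] by (simp add: \<sigma>_def)
  note fint = finite_set_trans_prob[OF game]
  define W where "W k x = (real k + 1 / c) * \<Phi> x + (- 2 * e * real k)" for k x
  obtain N :: nat where N: "3 / (c * e) \<le> real N" using real_arch_simple by blast
  have step: "W (Suc k) x \<le> measure_pmf.expectation (p x)
      (\<lambda>a. payoff \<Gamma> x a b + measure_pmf.expectation (trans_prob \<Gamma> x a b) (W k))"
    if b: "b \<in> acts2 \<Gamma> x" for k x b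
  proof (cases "x \<in> X0")
    case True
    have payoff0: "payoff \<Gamma> x a b = 0" if "a \<in> set_pmf (p x)" for a
      using rec True b subsetD[OF p that] by (simp add: recursive_game_def)
    have "(real k + 1 + 1 / c) * \<Phi> x - 2 * e * (real k + 1)
        \<le> (real k + 1 / c) * shapley \<Gamma> no_payoff \<Phi> x - 2 * e * real k"
    proof (rule weighted_potential_step)
      show "\<Phi> x \<le> 2 * e \<or> \<Phi> x + c \<le> shapley \<Gamma> no_payoff \<Phi> x"
        using T\<Phi>(2)[OF True] \<Phi>(2)[of x] by linarith
      show "\<Phi> x \<le> 1 + e" using \<Phi>(2)[of x] u[of x] by linarith
    qed (use c e T\<Phi>(1)[OF True] in auto)
    also have "\<dots> \<le> (real k + 1 / c) *
        measure_pmf.expectation (p x) (\<lambda>a. measure_pmf.expectation (trans_prob \<Gamma> x a b) \<Phi>) - 2 * e * real k"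
      using p_opt[OF b] c by (intro diff_right_mono mult_left_mono) auto
    also have "\<dots> = measure_pmf.expectation (p x)
        (\<lambda>a. measure_pmf.expectation (trans_prob \<Gamma> x a b) (W k))"
      unfolding W_def
      by (simp only: expectation_affine_finite_support[OF fint] expectation_affine_finite_support[OF finp])
    also have "\<dots> \<le> measure_pmf.expectation (p x)
        (\<lambda>a. payoff \<Gamma> x a b + measure_pmf.expectation (trans_prob \<Gamma> x a b) (W k))"
      using payoff0 by (intro expectation_mono_finite_support finp) simp
    finally show ?thesis by (simp add: W_def algebra_simps)
  next
    case False
    have "W (Suc k) x \<le> u x + W k x"
      using \<Phi>(2)[of x] e by (simp add: W_def algebra_simps)
    also have "\<dots> \<le> measure_pmf.expectation (p x)
        (\<lambda>a. payoff \<Gamma> x a b + measure_pmf.expectation (trans_prob \<Gamma> x a b) (W k))"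
    proof (intro expectation_ge_const finp)
      fix a assume "a \<in> set_pmf (p x)"
      then have a: "a \<in> acts1 \<Gamma> x" using p by blast
      have "pmf (trans_prob \<Gamma> x a b) x = 1" using rec False a b by (simp add: recursive_game_def)
      then show "u x + W k x \<le> payoff \<Gamma> x a b + measure_pmf.expectation (trans_prob \<Gamma> x a b) (W k)"
        using absorbing[OF False a b] by (simp add: expectation_absorbing)
    qed
    finally show ?thesis .
  qed
  have guarantee: "mean_payoff \<Gamma> n x \<sigma> \<tau> \<ge> u x - \<epsilon>"
    if n: "n \<ge> max 1 N" and \<tau>: "\<tau> \<in> strategies2 \<Gamma>" for n x \<tau>
  proof -
    have n1: "n \<ge> 1" and nN: "real n \<ge> real N" using n by auto
    have W0: "W 0 y \<le> 2 / c" for y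
    proof -
      have "\<Phi> y \<le> 2" using \<Phi>(2)[of y] u[of y] e by linarith
      then show ?thesis using c by (simp add: W_def divide_right_mono)
    qed
    have "W n x \<le> real n * mean_payoff \<Gamma> n x \<sigma> \<tau> + 2 / c"
      using step by (intro mean_payoff_ge[where W = W] game \<sigma> \<tau> n1 W0) (simp add: \<sigma>_def)
    moreover have "real n * u x - 1 / c - 2 * e * real n \<le> W n x"
    proof -
      have "real n * u x \<le> real n * \<Phi> x" using \<Phi>(1)[of x] by (intro mult_left_mono) auto
      moreover have "1 / c * (- 1) \<le> 1 / c * \<Phi> x"
        using \<Phi>(1)[of x] u[of x] c by (intro mult_left_mono) auto
      ultimately show ?thesis by (simp add: W_def algebra_simps)
    qed
    moreover have "3 / c \<le> real n * e"
      using order_trans[OF N nN] c e by (simp add: field_simps)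
    ultimately have "real n * (u x - 3 * e) \<le> real n * mean_payoff \<Gamma> n x \<sigma> \<tau>"
      by (simp add: algebra_simps)
    then have "u x - 3 * e \<le> mean_payoff \<Gamma> n x \<sigma> \<tau>"
      using n1 by (simp add: mult_le_cancel_left_pos)
    then show ?thesis using e by linarith
  qed
  have "\<sigma> \<in> strategies1 \<Gamma> \<inter> state_history_strategies"
    using \<sigma> by (auto simp: state_history_strategies_def \<sigma>_def)
  with guarantee show "\<exists>\<sigma>\<in>strategies1 \<Gamma> \<inter> state_history_strategies. \<exists>N\<ge>1. \<forall>x\<^sub>1\<in>X0. \<forall>n\<ge>N.
      \<forall>\<tau>\<in>strategies2 \<Gamma>. u x\<^sub>1 - \<epsilon> \<le> mean_payoff \<Gamma> n x\<^sub>1 \<sigma> \<tau>"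
    by (intro bexI[of _ \<sigma>] exI[of _ "max 1 N"]) auto
qed

text \<open>The mirror image: \<open>u\<close> and \<open>\<Phi>\<close> measure the gain of player 2, the negative of the payoff.\<close>

lemma player2_guarantees:
  fixes u :: "'x \<Rightarrow> real"
  assumes rec: "recursive_game \<Gamma> X0"
    and u: "\<And>x. - 1 \<le> u x \<and> u x \<le> 1"
    and absorbing: "\<And>x a b. x \<notin> X0 \<Longrightarrow> a \<in> acts1 \<Gamma> x \<Longrightarrow> b \<in> acts2 \<Gamma> x \<Longrightarrow> payoff \<Gamma> x a b = - u x"
    and potential: "\<And>\<epsilon>. 0 < \<epsilon> \<Longrightarrow> \<epsilon> \<le> 1 \<Longrightarrow> \<exists>\<Phi> c. c > 0 \<and> (\<forall>x. u x \<le> \<Phi> x \<and> \<Phi> x \<le> u x + \<epsilon>) \<and>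
      (\<forall>x\<in>X0. \<Phi> x \<le> - shapley \<Gamma> no_payoff (\<lambda>y. - \<Phi> y) x \<and>
        (\<epsilon> < u x \<longrightarrow> \<Phi> x + c \<le> - shapley \<Gamma> no_payoff (\<lambda>y. - \<Phi> y) x))"
  shows "uniformly_guarantees2 \<Gamma> X0 state_history_strategies (\<lambda>x. - u x)"
  unfolding uniformly_guarantees2_def
proof (intro allI impI)
  fix \<epsilon> :: real assume "\<epsilon> > 0"
  define e where "e = min 1 (\<epsilon> / 4)"
  have e: "0 < e" "e \<le> 1" "3 * e \<le> \<epsilon>" using \<open>\<epsilon> > 0\<close> by (auto simp: e_def)
  have game: "is_stochastic_game \<Gamma>" using rec by (simp add: recursive_game_def)
  obtain \<Phi> c where c: "c > 0" and \<Phi>: "\<And>x. u x \<le> \<Phi> x" "\<And>x. \<Phi> x \<le> u x + e"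
    and T\<Phi>: "\<And>x. x \<in> X0 \<Longrightarrow> \<Phi> x \<le> - shapley \<Gamma> no_payoff (\<lambda>y. - \<Phi> y) x"
      "\<And>x. x \<in> X0 \<Longrightarrow> e < u x \<Longrightarrow> \<Phi> x + c \<le> - shapley \<Gamma> no_payoff (\<lambda>y. - \<Phi> y) x"
    using potential[OF e(1,2)] by blast
  obtain q where q: "\<And>x. set_pmf (q x) \<subseteq> acts2 \<Gamma> x" and q_opt: "\<And>x a. a \<in> acts1 \<Gamma> x \<Longrightarrow>
      measure_pmf.expectation (q x) (\<lambda>b. 0 + measure_pmf.expectation (trans_prob \<Gamma> x a b) (\<lambda>y. - \<Phi> y))
      \<le> shapley \<Gamma> no_payoff (\<lambda>y. - \<Phi> y) x"
    using shapley_optimal2[OF game, of no_payoff "\<lambda>y. - \<Phi> y"] by blast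
  define \<tau> :: "('x, 'a, 'b, 'b) strategy" where "\<tau> = (\<lambda>h. q)"
  have \<tau>: "\<tau> \<in> strategies2 \<Gamma>" using q by (auto simp: strategies2_def \<tau>_def)
  have finq: "finite (set_pmf (q x))" for x using strategies2_support(2)[OF \<tau> game] by (simp add: \<tau>_def)
  note fint = finite_set_trans_prob[OF game]
  define W where "W k x = (- (real k + 1 / c)) * \<Phi> x + 2 * e * real k" for k x
  obtain N :: nat where N: "3 / (c * e) \<le> real N" using real_arch_simple by blast
  have step: "measure_pmf.expectation (q x)
      (\<lambda>b. payoff \<Gamma> x a b + measure_pmf.expectation (trans_prob \<Gamma> x a b) (W k)) \<le> W (Suc k) x"
    if a: "a \<in> acts1 \<Gamma> x" for k x a
  proof (cases "x \<in> X0")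
    case True
    have payoff0: "payoff \<Gamma> x a b = 0" if "b \<in> set_pmf (q x)" for b
      using rec True a subsetD[OF q that] by (simp add: recursive_game_def)
    let ?E = "measure_pmf.expectation (q x) (\<lambda>b. measure_pmf.expectation (trans_prob \<Gamma> x a b) \<Phi>)"
    have "measure_pmf.expectation (q x)
        (\<lambda>b. payoff \<Gamma> x a b + measure_pmf.expectation (trans_prob \<Gamma> x a b) (W k))
      \<le> measure_pmf.expectation (q x) (\<lambda>b. measure_pmf.expectation (trans_prob \<Gamma> x a b) (W k))"
      using payoff0 by (intro expectation_mono_finite_support finq) simp
    also have "\<dots> = (- (real k + 1 / c)) * ?E + 2 * e * real k"
      unfolding W_def
      by (simp only: expectation_affine_finite_support[OF fint] expectation_affine_finite_support[OF finq])
    finally have *: "measure_pmf.expectation (q x)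
        (\<lambda>b. payoff \<Gamma> x a b + measure_pmf.expectation (trans_prob \<Gamma> x a b) (W k))
      \<le> (- (real k + 1 / c)) * ?E + 2 * e * real k" .
    have "(real k + 1 + 1 / c) * \<Phi> x - 2 * e * (real k + 1)
        \<le> (real k + 1 / c) * (- shapley \<Gamma> no_payoff (\<lambda>y. - \<Phi> y) x) - 2 * e * real k"
    proof (rule weighted_potential_step)
      show "\<Phi> x \<le> 2 * e \<or> \<Phi> x + c \<le> - shapley \<Gamma> no_payoff (\<lambda>y. - \<Phi> y) x"
        using T\<Phi>(2)[OF True] \<Phi>(2)[of x] by linarith
      show "\<Phi> x \<le> 1 + e" using \<Phi>(2)[of x] u[of x] by linarith
    qed (use c e T\<Phi>(1)[OF True] in auto)
    also have "\<dots> \<le> (real k + 1 / c) * ?E - 2 * e * real k"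
      using q_opt[OF a] c by (intro diff_right_mono mult_left_mono) auto
    also have "\<dots> = - ((- (real k + 1 / c)) * ?E + 2 * e * real k)" by (simp add: algebra_simps)
    finally have "(- (real k + 1 / c)) * ?E + 2 * e * real k
        \<le> - ((real k + 1 + 1 / c) * \<Phi> x - 2 * e * (real k + 1))" by linarith
    with * have "measure_pmf.expectation (q x)
        (\<lambda>b. payoff \<Gamma> x a b + measure_pmf.expectation (trans_prob \<Gamma> x a b) (W k))
      \<le> - ((real k + 1 + 1 / c) * \<Phi> x - 2 * e * (real k + 1))" by (rule order_trans)
    then show ?thesis by (simp add: W_def algebra_simps)
  next
    case False
    have "measure_pmf.expectation (q x)
        (\<lambda>b. payoff \<Gamma> x a b + measure_pmf.expectation (trans_prob \<Gamma> x a b) (W k)) \<le> - u x + W k x"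
    proof (intro expectation_le_const finq)
      fix b assume "b \<in> set_pmf (q x)"
      then have b: "b \<in> acts2 \<Gamma> x" using q by blast
      have "pmf (trans_prob \<Gamma> x a b) x = 1" using rec False a b by (simp add: recursive_game_def)
      then show "payoff \<Gamma> x a b + measure_pmf.expectation (trans_prob \<Gamma> x a b) (W k) \<le> - u x + W k x"
        using absorbing[OF False a b] by (simp add: expectation_absorbing)
    qed
    also have "\<dots> \<le> W (Suc k) x"
      using \<Phi>(2)[of x] e by (simp add: W_def algebra_simps)
    finally show ?thesis .
  qed
  have guarantee: "mean_payoff \<Gamma> n x \<sigma> \<tau> \<le> - u x + \<epsilon>"
    if n: "n \<ge> max 1 N" and \<sigma>: "\<sigma> \<in> strategies1 \<Gamma>" for n x \<sigma>
  proof -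
    have n1: "n \<ge> 1" and nN: "real n \<ge> real N" using n by auto
    have W0: "- (2 / c) \<le> W 0 y" for y
    proof -
      have "\<Phi> y \<le> 2" using \<Phi>(2)[of y] u[of y] e by linarith
      then show ?thesis using c by (simp add: W_def divide_right_mono)
    qed
    have "real n * mean_payoff \<Gamma> n x \<sigma> \<tau> \<le> W n x + 2 / c"
      using step by (intro mean_payoff_le[where W = W] game \<sigma> \<tau> n1 W0) (simp add: \<tau>_def)
    moreover have "W n x \<le> - (real n * u x) + 1 / c + 2 * e * real n"
    proof -
      have "real n * u x \<le> real n * \<Phi> x" using \<Phi>(1)[of x] by (intro mult_left_mono) auto
      moreover have "1 / c * (- 1) \<le> 1 / c * \<Phi> x"
        using \<Phi>(1)[of x] u[of x] c by (intro mult_left_mono) auto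
      ultimately show ?thesis by (simp add: W_def algebra_simps)
    qed
    moreover have "3 / c \<le> real n * e"
      using order_trans[OF N nN] c e by (simp add: field_simps)
    ultimately have "real n * mean_payoff \<Gamma> n x \<sigma> \<tau> \<le> real n * (- u x + 3 * e)"
      by (simp add: algebra_simps)
    then have "mean_payoff \<Gamma> n x \<sigma> \<tau> \<le> - u x + 3 * e"
      using n1 by (simp add: mult_le_cancel_left_pos)
    then show ?thesis using e by linarith
  qed
  have "\<tau> \<in> strategies2 \<Gamma> \<inter> state_history_strategies"
    using \<tau> by (auto simp: state_history_strategies_def \<tau>_def)
  with guarantee show "\<exists>\<tau>\<in>strategies2 \<Gamma> \<inter> state_history_strategies. \<exists>N\<ge>1. \<forall>x\<^sub>1\<in>X0. \<forall>n\<ge>N.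
      \<forall>\<sigma>\<in>strategies1 \<Gamma>. mean_payoff \<Gamma> n x\<^sub>1 \<sigma> \<tau> \<le> - u x\<^sub>1 + \<epsilon>"
    by (intro bexI[of _ \<tau>] exI[of _ "max 1 N"]) auto
qed

section \<open>Values of a recursive game\<close>

lemma matrix_value_const:
  assumes "finite A" "finite B" "A \<noteq> {}" "B \<noteq> {}" "\<And>a b. a \<in> A \<Longrightarrow> b \<in> B \<Longrightarrow> M a b = v"
  shows "matrix_value A B M = v"
proof (rule matrix_value_unique[OF assms(1-4)])
  obtain a b where "a \<in> A" "b \<in> B" using assms by blast
  then show "is_matrix_value A B M v" unfolding is_matrix_value_def
    using assms(5) by (intro conjI exI[of _ "return_pmf a"] exI[of _ "return_pmf b"]) auto
qed

lemma shapley_mono: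
  assumes game: "is_stochastic_game \<Gamma>" and "\<And>y. f y \<le> g y"
    and "\<And>a b. a \<in> acts1 \<Gamma> x \<Longrightarrow> b \<in> acts2 \<Gamma> x \<Longrightarrow> r x a b \<le> r' x a b"
  shows "shapley \<Gamma> r f x \<le> shapley \<Gamma> r' g x"
proof (rule is_matrix_value_mono[OF _ _ shapley_is_matrix_value[OF game] shapley_is_matrix_value[OF game]])
  show "finite (acts1 \<Gamma> x)" "finite (acts2 \<Gamma> x)" using game by (auto simp: is_stochastic_game_def)
  show "r x a b + measure_pmf.expectation (trans_prob \<Gamma> x a b) f
      \<le> r' x a b + measure_pmf.expectation (trans_prob \<Gamma> x a b) g"
    if "a \<in> acts1 \<Gamma> x" "b \<in> acts2 \<Gamma> x" for a b
    using assms that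
    by (intro add_mono expectation_mono_finite_support finite_set_trans_prob) auto
qed

lemma shapley_affine:
  assumes game: "is_stochastic_game \<Gamma>" and "\<alpha> \<ge> 0"
  shows "shapley \<Gamma> no_payoff (\<lambda>y. \<alpha> * f y + \<beta>) x = \<alpha> * shapley \<Gamma> no_payoff f x + \<beta>"
proof -
  have acts: "finite (acts1 \<Gamma> x)" "finite (acts2 \<Gamma> x)" "acts1 \<Gamma> x \<noteq> {}" "acts2 \<Gamma> x \<noteq> {}"
    using game by (auto simp: is_stochastic_game_def)
  have "is_matrix_value (acts1 \<Gamma> x) (acts2 \<Gamma> x)
      (\<lambda>a b. \<alpha> * (0 + measure_pmf.expectation (trans_prob \<Gamma> x a b) f) + \<beta>)
      (\<alpha> * shapley \<Gamma> no_payoff f x + \<beta>)"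
    by (intro is_matrix_value_affine acts shapley_is_matrix_value[OF game] assms(2))
  then show ?thesis unfolding shapley_def[of \<Gamma> _ "\<lambda>y. \<alpha> * f y + \<beta>"]
    by (intro matrix_value_unique acts)
      (simp add: expectation_affine_finite_support[OF finite_set_trans_prob[OF game]])
qed

lemma total_value_bounds:
  assumes game: "is_stochastic_game \<Gamma>"
  shows "- real n \<le> total_value \<Gamma> n x \<and> total_value \<Gamma> n x \<le> real n"
proof (induction n arbitrary: x)
  case (Suc n)
  have pay: "- 1 \<le> payoff \<Gamma> y a b \<and> payoff \<Gamma> y a b \<le> 1" for y a b
    using game unfolding is_stochastic_game_def by auto
  have const: "shapley \<Gamma> (\<lambda>_ _ _. s) (\<lambda>_. t) x = s + t" for s t x
    unfolding shapley_def using game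
    by (intro matrix_value_const) (auto simp: is_stochastic_game_def)
  have "shapley \<Gamma> (\<lambda>_ _ _. - 1) (\<lambda>_. - real n) x \<le> total_value \<Gamma> (Suc n) x"
    "total_value \<Gamma> (Suc n) x \<le> shapley \<Gamma> (\<lambda>_ _ _. 1) (\<lambda>_. real n) x"
    unfolding total_value.simps using Suc pay by (auto intro!: shapley_mono[OF game])
  then show ?case by (simp add: const)
qed simp

lemma total_value_active:
  assumes rec: "recursive_game \<Gamma> X0" and x: "x \<in> X0"
  shows "total_value \<Gamma> (Suc n) x = shapley \<Gamma> no_payoff (total_value \<Gamma> n) x"
  using rec x unfolding total_value.simps
  by (intro antisym shapley_mono) (auto simp: recursive_game_def)

lemma total_value_absorbing:
  assumes rec: "recursive_game \<Gamma> X0" and x: "x \<notin> X0"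
    and c: "\<And>a b. a \<in> acts1 \<Gamma> x \<Longrightarrow> b \<in> acts2 \<Gamma> x \<Longrightarrow> payoff \<Gamma> x a b = c"
  shows "total_value \<Gamma> n x = real n * c"
proof (induction n)
  case (Suc n)
  have abs: "pmf (trans_prob \<Gamma> x a b) x = 1" if "a \<in> acts1 \<Gamma> x" "b \<in> acts2 \<Gamma> x" for a b
    using rec x that by (simp add: recursive_game_def)
  have "shapley \<Gamma> (payoff \<Gamma>) (total_value \<Gamma> n) x = c + real n * c"
    unfolding shapley_def
  proof (rule matrix_value_const)
    show "finite (acts1 \<Gamma> x)" "finite (acts2 \<Gamma> x)" "acts1 \<Gamma> x \<noteq> {}" "acts2 \<Gamma> x \<noteq> {}"
      using rec by (auto simp: recursive_game_def is_stochastic_game_def)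
  qed (simp add: expectation_absorbing abs c Suc)
  then show ?case by (simp add: algebra_simps)
qed simp

lemma totally_bounded_sup_nets:
  assumes "totally_bounded_sup F" "\<epsilon> > 0"
  shows "\<exists>K. finite K \<and> (\<forall>f\<in>F. \<exists>g\<in>K. \<forall>x. \<bar>g x - f x\<bar> \<le> \<epsilon>)"
proof -
  let ?M = "mspace sup_metric :: ('a \<Rightarrow> real) set" and ?d = "mdist (sup_metric :: ('a \<Rightarrow> real) metric)"
  interpret Metric_space ?M ?d by (rule Metric_space_mspace_mdist)
  obtain K where K: "finite K" "F \<subseteq> (\<Union>g\<in>K. mball g \<epsilon>)"
    using assms unfolding totally_bounded_sup_def mtotally_bounded_def by blast
  have "\<bar>g x - f x\<bar> \<le> \<epsilon>" if "f \<in> mball g \<epsilon>" for f g x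
  proof -
    have "f \<in> ?M" "g \<in> ?M" "?d g f \<le> \<epsilon>" using that[unfolded in_mball] by simp_all
    then have "\<forall>x\<in>UNIV. mdist euclidean_metric (g x) (f x) \<le> \<epsilon>"
      by (subst (asm) Urysohn.funspace_mdist_le) auto
    then show ?thesis by (simp add: dist_real_def)
  qed
  then have close: "\<forall>x. \<bar>g x - f x\<bar> \<le> \<epsilon>" if "f \<in> mball g \<epsilon>" for f g using that by simp
  show ?thesis
  proof (rule exI[of _ K], intro conjI ballI)
    fix f assume "f \<in> F"
    then have "f \<in> (\<Union>g\<in>K. mball g \<epsilon>)" by (rule subsetD[OF K(2)])
    then obtain g where "g \<in> K" "f \<in> mball g \<epsilon>" by (rule UN_E)
    then show "\<exists>g\<in>K. \<forall>x. \<bar>g x - f x\<bar> \<le> \<epsilon>" using close[of f g] by (intro bexI[of _ g])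
  qed (rule K(1))
qed

text \<open>Among the finitely many classes of indices that a net creates, the finite ones are exhausted
  after some \<open>N\<close>, and each infinite one has members beyond any \<open>K\<close>.\<close>

lemma recurrent_nets_of_totally_bounded:
  fixes V :: "nat \<Rightarrow> 'x \<Rightarrow> real"
  assumes "totally_bounded_sup {V n | n. n \<ge> 1}" "\<delta> > 0"
  shows "\<exists>N\<ge>1. \<forall>K. \<exists>J. finite J \<and> J \<subseteq> {K..} \<and> (\<forall>n\<ge>N. \<exists>j\<in>J. \<forall>x. \<bar>V n x - V j x\<bar> \<le> \<delta>)"
proof -
  obtain C where C: "finite C" "\<forall>f\<in>{V n | n. n \<ge> 1}. \<exists>g\<in>C. \<forall>x. \<bar>g x - f x\<bar> \<le> \<delta> / 2"
    using totally_bounded_sup_nets[OF assms(1), of "\<delta> / 2"] assms(2) by auto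
  define cls where "cls g = {n. \<forall>x. \<bar>g x - V n x\<bar> \<le> \<delta> / 2}" for g
  have in_cls: "\<exists>g\<in>C. n \<in> cls g" if "n \<ge> 1" for n using C(2) that by (auto simp: cls_def)
  have "finite (\<Union>g\<in>{g\<in>C. finite (cls g)}. cls g)" using C(1) by auto
  then obtain N where N: "\<forall>n\<in>(\<Union>g\<in>{g\<in>C. finite (cls g)}. cls g). n < N"
    using finite_nat_set_iff_bounded by blast
  have "\<exists>J. finite J \<and> J \<subseteq> {K..} \<and> (\<forall>n\<ge>max 1 N. \<exists>j\<in>J. \<forall>x. \<bar>V n x - V j x\<bar> \<le> \<delta>)" for K
  proof -
    have "\<exists>j\<ge>K. j \<in> cls g" if "infinite (cls g)" for g
      using that by (meson infinite_nat_iff_unbounded_le)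
    then obtain j where j: "\<And>g. infinite (cls g) \<Longrightarrow> K \<le> j g \<and> j g \<in> cls g" by metis
    have "\<exists>i\<in>j ` {g\<in>C. infinite (cls g)}. \<forall>x. \<bar>V n x - V i x\<bar> \<le> \<delta>" if n: "n \<ge> max 1 N" for n
    proof -
      obtain g where g: "g \<in> C" "n \<in> cls g" using in_cls n by auto
      have "infinite (cls g)" using N g n by force
      then have jg: "j g \<in> cls g" using j by blast
      have "\<bar>V n x - V (j g) x\<bar> \<le> \<delta>" for x
      proof -
        have "\<bar>g x - V n x\<bar> \<le> \<delta> / 2" "\<bar>g x - V (j g) x\<bar> \<le> \<delta> / 2"
          using g(2) jg unfolding cls_def by blast+
        then show ?thesis by linarith
      qed
      with g \<open>infinite (cls g)\<close> show ?thesis by blast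
    qed
    then show ?thesis
      using C(1) j by (intro exI[of _ "j ` {g\<in>C. infinite (cls g)}"]) auto
  qed
  then show ?thesis by (intro exI[of _ "max 1 N"]) auto
qed

section \<open>The uniform value\<close>

lemma uniformly_guarantees1_mono:
  "uniformly_guarantees1 \<Gamma> X0 S w \<Longrightarrow> S \<subseteq> S' \<Longrightarrow> uniformly_guarantees1 \<Gamma> X0 S' w"
  unfolding uniformly_guarantees1_def by blast

lemma uniformly_guarantees2_mono:
  assumes "uniformly_guarantees2 \<Gamma> X0 S w" "S \<subseteq> S'" "\<And>x. w x \<le> w' x"
  shows "uniformly_guarantees2 \<Gamma> X0 S' w'"
  unfolding uniformly_guarantees2_def
proof (intro allI impI)
  fix \<epsilon> :: real assume "\<epsilon> > 0"
  then obtain \<tau> N where \<tau>: "\<tau> \<in> strategies2 \<Gamma> \<inter> S" "N \<ge> 1"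
    and le: "\<And>x n \<sigma>. x \<in> X0 \<Longrightarrow> n \<ge> N \<Longrightarrow> \<sigma> \<in> strategies1 \<Gamma> \<Longrightarrow> mean_payoff \<Gamma> n x \<sigma> \<tau> \<le> w x + \<epsilon>"
    using assms(1) unfolding uniformly_guarantees2_def by blast
  have "mean_payoff \<Gamma> n x \<sigma> \<tau> \<le> w' x + \<epsilon>" if "x \<in> X0" "n \<ge> N" "\<sigma> \<in> strategies1 \<Gamma>" for x n \<sigma>
    using le[OF that] assms(3)[of x] by linarith
  with \<tau> assms(2) show "\<exists>\<tau>\<in>strategies2 \<Gamma> \<inter> S'. \<exists>N\<ge>1. \<forall>x\<in>X0. \<forall>n\<ge>N. \<forall>\<sigma>\<in>strategies1 \<Gamma>.
      mean_payoff \<Gamma> n x \<sigma> \<tau> \<le> w' x + \<epsilon>"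
    by (intro bexI[of _ \<tau>] exI[of _ N]) auto
qed

theorem theorem3p1:
  fixes \<Gamma> :: "('x, 'a, 'b) stochastic_game" and X0 :: "'x set"
  assumes "recursive_game \<Gamma> X0"
    and "totally_bounded_sup {n_stage_value \<Gamma> n | n. n \<ge> 1}"
  shows "\<exists>v. is_uniform_value \<Gamma> X0 v \<and>
             uniformly_guarantees1 \<Gamma> X0 state_history_strategies v \<and>
             uniformly_guarantees2 \<Gamma> X0 state_history_strategies v"
proof -
  have game: "is_stochastic_game \<Gamma>" using assms(1) by (simp add: recursive_game_def)
  let ?V = "n_stage_value \<Gamma>" and ?T = "shapley \<Gamma> no_payoff"
  have V: "?V n = (\<lambda>x. total_value \<Gamma> n x / real n)" if "n \<ge> 1" for n
    using n_stage_value_eq[OF game that] by blast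
  have bounds: "- 1 \<le> ?V n x \<and> ?V n x \<le> 1" if "n \<ge> 1" for n x
    using total_value_bounds[OF game, of n x] that by (simp add: V field_simps)
  have V_Suc: "real (Suc n) * ?V (Suc n) x = real n * ?T (?V n) x" if "n \<ge> 1" "x \<in> X0" for n x
  proof -
    have "total_value \<Gamma> n = (\<lambda>y. real n * ?V n y + 0)" using that by (simp add: V)
    then have "?T (total_value \<Gamma> n) x = real n * ?T (?V n) x"
      using shapley_affine[OF game, of "real n" "?V n" 0 x] by simp
    then show ?thesis using total_value_active[OF assms(1) that(2), of n] by (simp add: V)
  qed
  note nets = recurrent_nets_of_totally_bounded[OF assms(2)]
  interpret up: value_iteration ?T ?V X0
    by unfold_locales (use shapley_mono[OF game] shapley_affine[OF game] bounds V_Suc nets in auto)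
  interpret down: value_iteration "\<lambda>f x. - ?T (\<lambda>y. - f y) x" "\<lambda>n x. - ?V n x" X0
  proof unfold_locales
    show "- ?T (\<lambda>y. - f y) x \<le> - ?T (\<lambda>y. - g y) x" if "\<And>y. f y \<le> g y" for f g x
      using that shapley_mono[OF game, of "\<lambda>y. - g y" "\<lambda>y. - f y" x no_payoff no_payoff] by simp
    show "- ?T (\<lambda>y. - (\<alpha> * f y + \<beta>)) x = \<alpha> * - ?T (\<lambda>y. - f y) x + \<beta>" if "\<alpha> \<ge> 0" for \<alpha> f \<beta> x
      using shapley_affine[OF game that, of "\<lambda>y. - f y" "- \<beta>" x] by simp
    show "\<exists>N\<ge>1. \<forall>K. \<exists>J. finite J \<and> J \<subseteq> {K..} \<and>
        (\<forall>n\<ge>N. \<exists>j\<in>J. \<forall>x. \<bar>- ?V n x - - ?V j x\<bar> \<le> \<delta>)" if "\<delta> > 0" for \<delta>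
      using nets[OF that] by (simp add: abs_minus_commute)
  qed (use bounds V_Suc in auto)
  have limits: "up.upper_limit x = c" "down.upper_limit x = - c"
    if x: "x \<notin> X0" and c: "\<And>a b. a \<in> acts1 \<Gamma> x \<Longrightarrow> b \<in> acts2 \<Gamma> x \<Longrightarrow> payoff \<Gamma> x a b = c" for x c
  proof -
    have "total_value \<Gamma> n x = real n * c" for n by (rule total_value_absorbing[OF assms(1) x c])
    then have "?V n x = c" if "n \<ge> 1" for n using that by (simp add: V)
    then show "up.upper_limit x = c" "down.upper_limit x = - c"
      by (auto intro: up.upper_limit_const down.upper_limit_const)
  qed
  have absorbing: "payoff \<Gamma> x a b = up.upper_limit x" "payoff \<Gamma> x a b = - down.upper_limit x"
    if x: "x \<notin> X0" and "a \<in> acts1 \<Gamma> x" "b \<in> acts2 \<Gamma> x" for x a b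
  proof -
    have "\<exists>c. \<forall>a\<in>acts1 \<Gamma> x. \<forall>b\<in>acts2 \<Gamma> x. payoff \<Gamma> x a b = c"
      using assms(1) x by (simp add: recursive_game_def)
    then obtain c where c: "\<forall>a\<in>acts1 \<Gamma> x. \<forall>b\<in>acts2 \<Gamma> x. payoff \<Gamma> x a b = c" ..
    then have "up.upper_limit x = c" "down.upper_limit x = - c" using limits[OF x, of c] by blast+
    moreover have "payoff \<Gamma> x a b = c" using c that(2,3) by blast
    ultimately show "payoff \<Gamma> x a b = up.upper_limit x" "payoff \<Gamma> x a b = - down.upper_limit x"
      by linarith+
  qed
  have g1: "uniformly_guarantees1 \<Gamma> X0 state_history_strategies up.upper_limit"
    by (rule player1_guarantees[OF assms(1) _ absorbing(1) up.potential_exists])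
      (simp_all add: up.upper_limit_bounds)
  have g2: "uniformly_guarantees2 \<Gamma> X0 state_history_strategies (\<lambda>x. - down.upper_limit x)"
    by (rule player2_guarantees[OF assms(1) _ absorbing(2) down.potential_exists])
      (simp_all add: down.upper_limit_bounds)
  have "- down.upper_limit x \<le> up.upper_limit x" for x
  proof (rule field_le_epsilon)
    fix e :: real assume e: "e > 0"
    obtain N where N: "\<And>n. n \<ge> N \<Longrightarrow> ?V n x \<le> up.upper_limit x + e / 2"
      using up.upper_limit_eventually[of "e / 2"] e by auto
    obtain M where M: "\<And>n. n \<ge> M \<Longrightarrow> - ?V n x \<le> down.upper_limit x + e / 2"
      using down.upper_limit_eventually[of "e / 2"] e by auto
    show "- down.upper_limit x \<le> up.upper_limit x + e"
      using N[of "max N M"] M[of "max N M"] by simp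
  qed
  then have g2': "uniformly_guarantees2 \<Gamma> X0 state_history_strategies up.upper_limit"
    by (rule uniformly_guarantees2_mono[OF g2 subset_refl])
  have "is_uniform_value \<Gamma> X0 up.upper_limit"
    unfolding is_uniform_value_def
    using uniformly_guarantees1_mono[OF g1 subset_UNIV]
      uniformly_guarantees2_mono[OF g2' subset_UNIV order_refl] by (rule conjI)
  with g1 g2' show ?thesis by blast
qed

end
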